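(* For each $\theta\in\mathrm{IA}_n(\mathbb Z/3)$, every $\theta$-periodic conjugacy class in $F_n$ is fixed by $\theta$.
   Context: $F_n$ is the free group of rank $n$, and $\mathrm{IA}_n(\mathbb Z/3)$ is the kernel of the natural homomorphism $\mathrm{Out}(F_n)\to \mathrm{Aut}(H_1(F_n;\mathbb Z/3))$. $\mathrm{Out}(F_n)$ acts on the set of conjugacy classes of elements of $F_n$. A conjugacy class $c$ is $\theta$-periodic if $\theta^k(c)=c$ for some $k\ge 1$. *)

theory Defs
  imports "HOL-Algebra.Generated_Groups" "HOL-Algebra.Bij" "HOL-Algebra.Group_Action"
begin

section \<open>Free groups\<close>

text \<open>The letter \<open>(s, True)\<close> stands for the generator \<open>s\<close> and \<open>(s, False)\<close> for its inverse.\<close>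

type_synonym 's letter = "'s \<times> bool"

definition letter_inv :: "'s letter \<Rightarrow> 's letter" where
  "letter_inv a = (fst a, \<not> snd a)"

definition reduced :: "'s letter list \<Rightarrow> bool" where
  "reduced w \<longleftrightarrow> successively (\<lambda>a b. b \<noteq> letter_inv a) w"

fun cons_red :: "'s letter \<Rightarrow> 's letter list \<Rightarrow> 's letter list" where
  "cons_red a [] = [a]"
| "cons_red a (b # w) = (if b = letter_inv a then w else a # b # w)"

definition reduce :: "'s letter list \<Rightarrow> 's letter list" where
  "reduce w = foldr cons_red w []"

definition free_group :: "'s set \<Rightarrow> 's letter list monoid" where
  "free_group S = \<lparr>carrier = {w \<in> lists (S \<times> UNIV). reduced w},
                   monoid.mult = (\<lambda>u v. reduce (u @ v)),
                   one = []\<rparr>"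


section \<open>Outer automorphisms\<close>

definition conjugation :: "('a, 'b) monoid_scheme \<Rightarrow> 'a \<Rightarrow> 'a \<Rightarrow> 'a" where
  "conjugation G g = (\<lambda>x \<in> carrier G. g \<otimes>\<^bsub>G\<^esub> x \<otimes>\<^bsub>G\<^esub> inv\<^bsub>G\<^esub> g)"

definition inner_auto :: "('a, 'b) monoid_scheme \<Rightarrow> ('a \<Rightarrow> 'a) set" where
  "inner_auto G = conjugation G ` carrier G"

definition OutGroup :: "('a, 'b) monoid_scheme \<Rightarrow> ('a \<Rightarrow> 'a) set monoid" where
  "OutGroup G = AutoGroup G Mod inner_auto G"


section \<open>First homology modulo \<open>m\<close>\<close>

definition abelianization :: "('a, 'b) monoid_scheme \<Rightarrow> 'a set monoid" where
  "abelianization G = G Mod derived G (carrier G)"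

definition powers :: "nat \<Rightarrow> ('a, 'b) monoid_scheme \<Rightarrow> 'a set" where
  "powers m G = (\<lambda>x. x [^]\<^bsub>G\<^esub> m) ` carrier G"

text \<open>\<open>H\<^sub>1(G; \<int>/m)\<close> is the quotient of the integral homology \<open>H\<^sub>1(G; \<int>)\<close>, which is the
  abelianization of \<open>G\<close>, by its multiples of \<open>m\<close> (written multiplicatively here).\<close>

definition H1_mod :: "nat \<Rightarrow> ('a, 'b) monoid_scheme \<Rightarrow> 'a set set monoid" where
  "H1_mod m G = abelianization G Mod powers m (abelianization G)"

definition quotient_map ::
    "('a, 'b) monoid_scheme \<Rightarrow> 'a set \<Rightarrow> ('a \<Rightarrow> 'a) \<Rightarrow> 'a set \<Rightarrow> 'a set" where
  "quotient_map G N \<phi> = (\<lambda>X \<in> carrier (G Mod N). \<phi> ` X)"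

definition H1_map ::
    "nat \<Rightarrow> ('a, 'b) monoid_scheme \<Rightarrow> ('a \<Rightarrow> 'a) \<Rightarrow> 'a set set \<Rightarrow> 'a set set" where
  "H1_map m G \<phi> = quotient_map (abelianization G) (powers m (abelianization G))
                     (quotient_map G (derived G (carrier G)) \<phi>)"

text \<open>An outer automorphism is a coset of automorphisms; all its members induce the same map
  on homology (\<open>Out_H1_eq\<close> below) and on conjugacy classes (\<open>Out_conj_eq\<close>).\<close>

definition Out_H1 ::
    "nat \<Rightarrow> ('a, 'b) monoid_scheme \<Rightarrow> ('a \<Rightarrow> 'a) set \<Rightarrow> 'a set set \<Rightarrow> 'a set set" where
  "Out_H1 m G \<theta> = the_elem (H1_map m G ` \<theta>)"

definition IA :: "nat \<Rightarrow> ('a, 'b) monoid_scheme \<Rightarrow> ('a \<Rightarrow> 'a) set set" where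
  "IA m G = kernel (OutGroup G) (AutoGroup (H1_mod m G)) (Out_H1 m G)"


section \<open>The action on conjugacy classes\<close>

definition conj_classes :: "('a, 'b) monoid_scheme \<Rightarrow> 'a set set" where
  "conj_classes G = orbits G (carrier G) (conjugation G)"

definition Out_conj :: "('a, 'b) monoid_scheme \<Rightarrow> ('a \<Rightarrow> 'a) set \<Rightarrow> 'a set \<Rightarrow> 'a set" where
  "Out_conj G \<theta> = (\<lambda>c \<in> conj_classes G. the_elem ((\<lambda>\<phi>. \<phi> ` c) ` \<theta>))"

definition periodic_class :: "('a, 'b) monoid_scheme \<Rightarrow> ('a \<Rightarrow> 'a) set \<Rightarrow> 'a set \<Rightarrow> bool" where
  "periodic_class G \<theta> c \<longleftrightarrow> (\<exists>k::nat. k \<ge> 1 \<and> Out_conj G (\<theta> [^]\<^bsub>OutGroup G\<^esub> k) c = c)"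


section \<open>Well-definedness\<close>

subsection \<open>The free group is a group with the expected universal property\<close>

lemma letter_inv_invol [simp]: "letter_inv (letter_inv a) = a"
  by (simp add: letter_inv_def)

lemma letter_inv_eq_iff: "letter_inv a = b \<longleftrightarrow> a = letter_inv b"
  by (metis letter_inv_invol)

lemma reduced_Nil [simp]: "reduced []"
  by (simp add: reduced_def)

lemma reduced_ConsD: "reduced (a # w) \<Longrightarrow> reduced w"
  by (cases w) (auto simp: reduced_def)

lemma reduced_cons_red: "reduced w \<Longrightarrow> reduced (cons_red a w)"
  by (cases w) (auto simp: reduced_def successively_Cons)

lemma cons_red_eq_Cons: "reduced (a # w) \<Longrightarrow> cons_red a w = a # w"
  by (cases w) (auto simp: reduced_def)

lemma cons_red_cancel: "reduced w \<Longrightarrow> cons_red a (cons_red (letter_inv a) w) = w"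
  by (cases w) (auto simp: cons_red_eq_Cons)

lemma reduced_foldr: "reduced v \<Longrightarrow> reduced (foldr cons_red u v)"
  by (induction u) (auto simp: reduced_cons_red)

lemma reduced_reduce: "reduced (reduce w)"
  by (simp add: reduce_def reduced_foldr)

lemma reduce_reduced: "reduced w \<Longrightarrow> reduce w = w"
proof (induction w)
  case (Cons a w)
  then show ?case using cons_red_eq_Cons[of a w] reduced_ConsD[of a w] by (simp add: reduce_def)
qed (simp add: reduce_def)

lemma foldr_cons_red: "reduced v \<Longrightarrow> foldr cons_red (cons_red a u) v = cons_red a (foldr cons_red u v)"
  by (cases u) (auto simp: cons_red_cancel reduced_foldr)

lemma foldr_reduce: "reduced v \<Longrightarrow> foldr cons_red (reduce u) v = foldr cons_red u v"
  by (induction u) (auto simp: reduce_def foldr_cons_red)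

lemma reduce_append1: "reduce (reduce u @ v) = reduce (u @ v)"
  using foldr_reduce[of "reduce v" u] reduced_reduce[of v] by (simp add: reduce_def)

lemma reduce_append2: "reduce (u @ reduce v) = reduce (u @ v)"
  using reduce_reduced[OF reduced_reduce[of v]] by (simp add: reduce_def)

lemma set_cons_red: "set (cons_red a w) \<subseteq> insert a (set w)"
  by (cases w) auto

lemma set_reduce: "set (reduce w) \<subseteq> set w"
proof (induction w)
  case (Cons a w)
  then show ?case using set_cons_red[of a "reduce w"] by (auto simp: reduce_def)
qed (simp add: reduce_def)

lemma reduce_inverse_word: "reduce (map letter_inv (rev w) @ w) = []"
proof (induction w)
  case (Cons a w)
  have "cons_red (letter_inv a) (cons_red a (reduce w)) = reduce w"
    using cons_red_cancel[of "reduce w" "letter_inv a"] by (simp add: reduced_reduce)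
  then have "reduce (map letter_inv (rev (a # w)) @ a # w)
      = foldr cons_red (map letter_inv (rev w)) (reduce w)"
    by (simp add: reduce_def)
  also have "\<dots> = []" using Cons by (simp add: reduce_def)
  finally show ?case .
qed (simp add: reduce_def)

theorem group_free_group: "group (free_group S)"
proof (rule groupI)
  fix x y assume "x \<in> carrier (free_group S)" "y \<in> carrier (free_group S)"
  then show "x \<otimes>\<^bsub>free_group S\<^esub> y \<in> carrier (free_group S)"
    using set_reduce[of "x @ y"] by (auto simp: free_group_def reduced_reduce lists_eq_set)
next
  fix x assume x: "x \<in> carrier (free_group S)"
  let ?y = "reduce (map letter_inv (rev x))"
  have "?y \<in> carrier (free_group S)"
    using x set_reduce[of "map letter_inv (rev x)"]
    by (force simp: free_group_def reduced_reduce lists_eq_set letter_inv_def)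
  moreover have "?y \<otimes>\<^bsub>free_group S\<^esub> x = \<one>\<^bsub>free_group S\<^esub>"
    by (simp add: free_group_def reduce_append1 reduce_inverse_word)
  ultimately show "\<exists>y\<in>carrier (free_group S). y \<otimes>\<^bsub>free_group S\<^esub> x = \<one>\<^bsub>free_group S\<^esub>" by blast
qed (auto simp: free_group_def reduce_append1 reduce_append2 reduce_reduced)

fun eval_letter :: "('a, 'b) monoid_scheme \<Rightarrow> ('s \<Rightarrow> 'a) \<Rightarrow> 's letter \<Rightarrow> 'a" where
  "eval_letter G f (s, b) = (if b then f s else inv\<^bsub>G\<^esub> f s)"

fun eval_word :: "('a, 'b) monoid_scheme \<Rightarrow> ('s \<Rightarrow> 'a) \<Rightarrow> 's letter list \<Rightarrow> 'a" where
  "eval_word G f [] = \<one>\<^bsub>G\<^esub>"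
| "eval_word G f (a # w) = eval_letter G f a \<otimes>\<^bsub>G\<^esub> eval_word G f w"

lemma generator_in_free_group: "s \<in> S \<Longrightarrow> [(s, b)] \<in> carrier (free_group S)"
  by (simp add: free_group_def reduced_def)

theorem free_group_universal:
  assumes "group G" and f: "f \<in> S \<rightarrow> carrier G"
  shows "\<exists>!h. h \<in> hom (free_group S) G \<inter> extensional (carrier (free_group S))
            \<and> (\<forall>s\<in>S. h [(s, True)] = f s)"
proof -
  interpret G: group G by fact
  interpret F: group "free_group S" by (rule group_free_group)
  let ?F = "free_group S"
  have L: "eval_letter G f a \<in> carrier G" if "a \<in> S \<times> UNIV" for a
    using that f by (cases a) auto
  have W: "eval_word G f w \<in> carrier G" if "set w \<subseteq> S \<times> UNIV" for w
    using that by (induction w) (auto intro!: L)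
  have A: "eval_word G f (u @ v) = eval_word G f u \<otimes>\<^bsub>G\<^esub> eval_word G f v"
    if "set u \<subseteq> S \<times> UNIV" "set v \<subseteq> S \<times> UNIV" for u v
    using that by (induction u) (auto simp: G.m_assoc L W)
  have C: "eval_word G f (cons_red a w) = eval_letter G f a \<otimes>\<^bsub>G\<^esub> eval_word G f w"
    if "a \<in> S \<times> UNIV" "set w \<subseteq> S \<times> UNIV" for a w
  proof (cases w)
    case (Cons b v)
    have "eval_letter G f a \<otimes>\<^bsub>G\<^esub> (eval_letter G f (letter_inv a) \<otimes>\<^bsub>G\<^esub> eval_word G f v)
         = eval_word G f v"
      using that f Cons L[of a] W[of v]
      by (cases a) (auto simp: letter_inv_def G.m_assoc[symmetric] Pi_iff)
    then show ?thesis using Cons by auto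
  qed simp
  have R: "eval_word G f (reduce w) = eval_word G f w" if "set w \<subseteq> S \<times> UNIV" for w
    using that
  proof (induction w)
    case (Cons a w)
    then have "set (reduce w) \<subseteq> S \<times> UNIV" using set_reduce[of w] by auto
    then show ?case using Cons C[of a "reduce w"] by (simp add: reduce_def)
  qed (simp add: reduce_def)
  let ?h = "restrict (eval_word G f) (carrier ?F)"
  have h1: "?h \<in> hom ?F G"
  proof (rule homI)
    fix x y assume xy: "x \<in> carrier ?F" "y \<in> carrier ?F"
    then have s: "set x \<subseteq> S \<times> UNIV" "set y \<subseteq> S \<times> UNIV" by (auto simp: free_group_def)
    then have "eval_word G f (x \<otimes>\<^bsub>?F\<^esub> y) = eval_word G f x \<otimes>\<^bsub>G\<^esub> eval_word G f y"
      using R[of "x @ y"] A[of x y] by (simp add: free_group_def)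
    then show "?h (x \<otimes>\<^bsub>?F\<^esub> y) = ?h x \<otimes>\<^bsub>G\<^esub> ?h y" using xy F.m_closed[of x y] by simp
  qed (auto simp: free_group_def intro!: W)
  have h2: "?h [(s, True)] = f s" if "s \<in> S" for s
    using that f generator_in_free_group[of s S True] by (auto simp: Pi_iff)
  have U: "h = ?h" if h: "h \<in> hom ?F G" "h \<in> extensional (carrier ?F)"
      "\<And>s. s \<in> S \<Longrightarrow> h [(s, True)] = f s" for h
  proof (rule extensionalityI[OF h(2)])
    interpret h: group_hom ?F G h
      using h(1) by (simp add: group_hom_def group_hom_axioms_def)
    have "h [(s, b)] = eval_letter G f (s, b)" if s: "s \<in> S" for s b
    proof (cases b)
      case False
      have "[(s, False)] \<otimes>\<^bsub>?F\<^esub> [(s, True)] = \<one>\<^bsub>?F\<^esub>"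
        by (simp add: free_group_def reduce_def letter_inv_def)
      then have "[(s, False)] = inv\<^bsub>?F\<^esub> [(s, True)]"
        using generator_in_free_group s by (metis F.inv_equality)
      then show ?thesis using False h(3)[OF s] generator_in_free_group[OF s, of True]
        by (simp add: h.hom_inv)
    qed (use h(3)[OF s] in simp)
    then have hl: "h [a] = eval_letter G f a" if "a \<in> S \<times> UNIV" for a
      using that by (cases a) auto
    have "h x = eval_word G f x" if "x \<in> carrier ?F" for x
      using that
    proof (induction x)
      case Nil
      then show ?case using h.hom_one by (simp add: free_group_def)
    next
      case (Cons a w)
      then have w: "w \<in> carrier ?F" and a: "a \<in> S \<times> UNIV" and ra: "reduced (a # w)"
        by (auto simp: free_group_def dest: reduced_ConsD)
      have a': "[a] \<in> carrier ?F" using a by (auto simp: generator_in_free_group)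
      have "a # w = [a] \<otimes>\<^bsub>?F\<^esub> w"
        using reduce_reduced[OF ra] by (simp add: free_group_def)
      then have "h (a # w) = h [a] \<otimes>\<^bsub>G\<^esub> h w" using a' w by simp
      then show ?case using Cons.IH[OF w] hl[OF a] by simp
    qed
    then show "h x = ?h x" if "x \<in> carrier ?F" for x using that by simp
  qed simp
  show ?thesis
  proof (rule ex1I[of _ ?h])
    show "?h \<in> hom ?F G \<inter> extensional (carrier ?F) \<and> (\<forall>s\<in>S. ?h [(s, True)] = f s)"
      using h1 h2 restrict_extensional by blast
  next
    fix h assume "h \<in> hom ?F G \<inter> extensional (carrier ?F) \<and> (\<forall>s\<in>S. h [(s, True)] = f s)"
    then show "h = ?h" by (intro U) blast+
  qed
qed


subsection \<open>Inner automorphisms\<close>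

lemma AutoGroup_simps:
  "carrier (AutoGroup G) = auto G"
  "\<one>\<^bsub>AutoGroup G\<^esub> = (\<lambda>x \<in> carrier G. x)"
  by (auto simp: AutoGroup_def BijGroup_def)

lemma AutoGroup_mult:
  "\<phi> \<in> auto G \<Longrightarrow> \<psi> \<in> auto G \<Longrightarrow> \<phi> \<otimes>\<^bsub>AutoGroup G\<^esub> \<psi> = compose (carrier G) \<phi> \<psi>"
  by (auto simp: AutoGroup_def BijGroup_def auto_def)

lemma autoD:
  assumes "\<phi> \<in> auto G"
  shows "\<phi> \<in> hom G G" "\<phi> \<in> extensional (carrier G)" "\<phi> ` carrier G = carrier G"
    "inj_on \<phi> (carrier G)" "\<And>x. x \<in> carrier G \<Longrightarrow> \<phi> x \<in> carrier G"
  using assms by (auto simp: auto_def Bij_def bij_betw_def)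

context group
begin

lemma auto_group_hom: "\<phi> \<in> auto G \<Longrightarrow> group_hom G G \<phi>"
  by (simp add: group_hom_def group_hom_axioms_def is_group autoD(1))

lemma conjugation_auto: "g \<in> carrier G \<Longrightarrow> conjugation G g \<in> auto G"
proof -
  assume g: "g \<in> carrier G"
  have "conjugation G g \<in> hom G G"
    using g by (auto simp: conjugation_def hom_def m_assoc inv_solve_left)
  moreover have "conjugation G g \<in> Bij (carrier G)"
    using conjugation_is_bij[OF g] by (simp add: conjugation_def Bij_def)
  ultimately show ?thesis by (simp add: auto_def)
qed

lemma auto_conjugation:
  assumes "\<phi> \<in> auto G" "g \<in> carrier G" "x \<in> carrier G"
  shows "\<phi> (conjugation G g x) = conjugation G (\<phi> g) (\<phi> x)"
proof -
  interpret group_hom G G \<phi> using assms(1) by (rule auto_group_hom)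
  show ?thesis using assms by (simp add: conjugation_def)
qed

lemma conjugation_group_hom: "group_hom G (AutoGroup G) (conjugation G)"
proof -
  have "conjugation G \<in> hom G (AutoGroup G)"
  proof (rule homI)
    fix x y assume xy: "x \<in> carrier G" "y \<in> carrier G"
    show "conjugation G (x \<otimes> y) = conjugation G x \<otimes>\<^bsub>AutoGroup G\<^esub> conjugation G y"
      unfolding AutoGroup_mult[OF conjugation_auto[OF xy(1)] conjugation_auto[OF xy(2)]]
      using xy by (auto simp: conjugation_def compose_def fun_eq_iff m_assoc inv_mult_group)
  qed (simp add: AutoGroup_simps conjugation_auto)
  then show ?thesis by (simp add: group_hom_def group_hom_axioms_def is_group AutoGroup)
qed

lemma inner_auto_normal: "inner_auto G \<lhd> AutoGroup G"
proof -
  interpret A: group "AutoGroup G" by (rule AutoGroup)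
  have "subgroup (inner_auto G) (AutoGroup G)"
    unfolding inner_auto_def using conjugation_group_hom group_hom.img_is_subgroup by blast
  moreover have "\<phi> \<otimes>\<^bsub>AutoGroup G\<^esub> h \<otimes>\<^bsub>AutoGroup G\<^esub> inv\<^bsub>AutoGroup G\<^esub> \<phi> \<in> inner_auto G"
    if \<phi>: "\<phi> \<in> carrier (AutoGroup G)" and h: "h \<in> inner_auto G" for \<phi> h
  proof -
    obtain g where g: "g \<in> carrier G" "h = conjugation G g"
      using h by (auto simp: inner_auto_def)
    have p: "\<phi> \<in> auto G" using \<phi> by (simp add: AutoGroup_simps)
    have pg: "\<phi> g \<in> carrier G" using p g by (simp add: autoD)
    have "\<phi> \<otimes>\<^bsub>AutoGroup G\<^esub> h = conjugation G (\<phi> g) \<otimes>\<^bsub>AutoGroup G\<^esub> \<phi>"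
      using g pg p by (simp add: AutoGroup_mult conjugation_auto)
        (auto simp: compose_def fun_eq_iff auto_conjugation)
    moreover have "conjugation G (\<phi> g) \<in> carrier (AutoGroup G)" "h \<in> carrier (AutoGroup G)"
      using g pg by (auto simp: AutoGroup_simps conjugation_auto)
    ultimately have "\<phi> \<otimes>\<^bsub>AutoGroup G\<^esub> h \<otimes>\<^bsub>AutoGroup G\<^esub> inv\<^bsub>AutoGroup G\<^esub> \<phi> = conjugation G (\<phi> g)"
      using \<phi> by (simp add: A.m_assoc)
    then show ?thesis using pg by (simp add: inner_auto_def)
  qed
  ultimately show ?thesis by (simp add: A.normal_inv_iff)
qed

lemma group_OutGroup: "group (OutGroup G)"
  unfolding OutGroup_def using inner_auto_normal by (rule normal.factorgroup_is_group)

lemma carrier_OutGroup: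
  "carrier (OutGroup G) = (\<lambda>\<phi>. inner_auto G #>\<^bsub>AutoGroup G\<^esub> \<phi>) ` auto G"
  by (simp add: OutGroup_def carrier_FactGroup AutoGroup_simps)

lemma OutGroup_mult:
  assumes "\<phi> \<in> auto G" "\<psi> \<in> auto G"
  shows "(inner_auto G #>\<^bsub>AutoGroup G\<^esub> \<phi>) \<otimes>\<^bsub>OutGroup G\<^esub> (inner_auto G #>\<^bsub>AutoGroup G\<^esub> \<psi>)
       = inner_auto G #>\<^bsub>AutoGroup G\<^esub> compose (carrier G) \<phi> \<psi>"
  using assms normal.rcos_sum[OF inner_auto_normal, of \<phi> \<psi>]
  by (simp add: OutGroup_def AutoGroup_simps AutoGroup_mult)

lemma inner_coset:
  assumes "\<phi> \<in> auto G"
  shows "inner_auto G #>\<^bsub>AutoGroup G\<^esub> \<phi>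
       = (\<lambda>g. compose (carrier G) (conjugation G g) \<phi>) ` carrier G"
  using assms by (auto simp: r_coset_def inner_auto_def AutoGroup_mult conjugation_auto)

lemma compose_auto: "\<phi> \<in> auto G \<Longrightarrow> \<psi> \<in> auto G \<Longrightarrow> compose (carrier G) \<phi> \<psi> \<in> auto G"
  by (metis AutoGroup AutoGroup_mult AutoGroup_simps(1) group.is_monoid monoid.m_closed)

end

lemma the_elem_image_const:
  assumes "A \<noteq> {}" "\<And>x. x \<in> A \<Longrightarrow> f x = c"
  shows "the_elem (f ` A) = c"
proof -
  have "f ` A = {c}" using assms by (simp add: image_constant_conv cong: image_cong)
  then show ?thesis by simp
qed


subsection \<open>The action of outer automorphisms on homology\<close>

context normal
begin

lemma image_coset:
  assumes "\<phi> \<in> auto G" "\<phi> ` H = H" "x \<in> carrier G"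
  shows "\<phi> ` (H #> x) = H #> \<phi> x"
proof -
  interpret group_hom G G \<phi> using assms(1) by (rule auto_group_hom)
  have c: "H #> y = (\<lambda>h. h \<otimes> y) ` H" for y
    by (auto simp: r_coset_def)
  have "\<phi> ` (H #> x) = (\<lambda>h. h \<otimes> \<phi> x) ` (\<phi> ` H)"
    unfolding c image_image using assms(3) by (intro image_cong refl) simp
  then show ?thesis by (simp only: assms(2) c)
qed

lemma quotient_map_coset:
  assumes "\<phi> \<in> auto G" "\<phi> ` H = H" "x \<in> carrier G"
  shows "quotient_map G H \<phi> (H #> x) = H #> \<phi> x"
proof -
  have "H #> x \<in> carrier (G Mod H)" using assms(3) unfolding carrier_FactGroup by (rule imageI)
  then show ?thesis unfolding quotient_map_def by (simp only: restrict_apply if_True image_coset[OF assms])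
qed

lemma quotient_map_auto:
  assumes \<phi>: "\<phi> \<in> auto G" "\<phi> ` H = H"
  shows "quotient_map G H \<phi> \<in> auto (G Mod H)"
proof -
  interpret group_hom G G \<phi> using assms(1) by (rule auto_group_hom)
  note q = quotient_map_coset[OF \<phi>]
  have sub: "X \<subseteq> carrier G" if "X \<in> carrier (G Mod H)" for X
    using that r_coset_subset_G[OF subset] by (auto simp: carrier_FactGroup)
  have img: "quotient_map G H \<phi> ` carrier (G Mod H) = carrier (G Mod H)"
  proof -
    have "quotient_map G H \<phi> ` carrier (G Mod H) = (\<lambda>x. H #> x) ` (\<phi> ` carrier G)"
      unfolding carrier_FactGroup image_image by (intro image_cong refl q)
    then show ?thesis by (simp only: autoD(3)[OF \<phi>(1)] carrier_FactGroup)
  qed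
  have inj: "inj_on (quotient_map G H \<phi>) (carrier (G Mod H))"
  proof (rule inj_onI)
    fix X Y
    assume XY: "X \<in> carrier (G Mod H)" "Y \<in> carrier (G Mod H)"
      "quotient_map G H \<phi> X = quotient_map G H \<phi> Y"
    then have "\<phi> ` X = \<phi> ` Y" by (simp only: quotient_map_def restrict_apply if_True)
    then show "X = Y"
      using inj_on_image_eq_iff[OF autoD(4)[OF \<phi>(1)] sub[OF XY(1)] sub[OF XY(2)]] by (rule iffD1[rotated])
  qed
  have "quotient_map G H \<phi> \<in> hom (G Mod H) (G Mod H)"
  proof (rule homI)
    fix X Y assume "X \<in> carrier (G Mod H)" "Y \<in> carrier (G Mod H)"
    then obtain x y where xy: "x \<in> carrier G" "y \<in> carrier G" "X = H #> x" "Y = H #> y"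
      unfolding carrier_FactGroup by blast
    have "X \<otimes>\<^bsub>G Mod H\<^esub> Y = H #> (x \<otimes> y)"
      using rcos_sum[OF xy(1,2)] by (simp only: xy(3,4) mult_FactGroup)
    moreover have "quotient_map G H \<phi> X \<otimes>\<^bsub>G Mod H\<^esub> quotient_map G H \<phi> Y = H #> (\<phi> x \<otimes> \<phi> y)"
      using rcos_sum[of "\<phi> x" "\<phi> y"] xy(1,2)
      by (simp only: xy(3,4) q mult_FactGroup hom_closed)
    ultimately show "quotient_map G H \<phi> (X \<otimes>\<^bsub>G Mod H\<^esub> Y)
        = quotient_map G H \<phi> X \<otimes>\<^bsub>G Mod H\<^esub> quotient_map G H \<phi> Y"
      using xy(1,2) by (simp only: q m_closed hom_mult)
  qed (use img in blast)
  moreover have "quotient_map G H \<phi> \<in> extensional (carrier (G Mod H))"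
    unfolding quotient_map_def by (rule restrict_extensional)
  ultimately show ?thesis using img inj unfolding auto_def Bij_def bij_betw_def by blast
qed

lemma quotient_map_compose:
  assumes "\<phi> \<in> auto G" "\<phi> ` H = H" "\<psi> \<in> auto G" "\<psi> ` H = H"
  shows "quotient_map G H (compose (carrier G) \<phi> \<psi>)
       = compose (carrier (G Mod H)) (quotient_map G H \<phi>) (quotient_map G H \<psi>)"
proof
  fix X
  show "quotient_map G H (compose (carrier G) \<phi> \<psi>) X
      = compose (carrier (G Mod H)) (quotient_map G H \<phi>) (quotient_map G H \<psi>) X"
  proof (cases "X \<in> carrier (G Mod H)")
    case True
    then obtain x where x: "x \<in> carrier G" "X = H #> x" by (auto simp: carrier_FactGroup)
    have "compose (carrier G) \<phi> \<psi> ` H = (\<lambda>x. \<phi> (\<psi> x)) ` H"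
      using subset by (intro image_cong refl) (auto simp: compose_def)
    also have "\<dots> = \<phi> ` (\<psi> ` H)" by (rule image_image[symmetric])
    also have "\<dots> = H" by (simp only: assms)
    finally have "quotient_map G H (compose (carrier G) \<phi> \<psi>) X = H #> compose (carrier G) \<phi> \<psi> x"
      unfolding x(2) using x(1) by (intro quotient_map_coset compose_auto assms)
    also have "\<dots> = H #> \<phi> (\<psi> x)" using x(1) by (simp only: compose_def restrict_apply if_True)
    also have "\<dots> = quotient_map G H \<phi> (quotient_map G H \<psi> X)"
      unfolding x(2) using assms x(1) by (simp only: quotient_map_coset autoD(5))
    finally show ?thesis using True by (simp only: compose_def restrict_apply if_True)
  qed (simp add: quotient_map_def compose_def)
qed

end

lemma (in group) auto_image_derived:
  assumes "\<phi> \<in> auto G"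
  shows "\<phi> ` derived G (carrier G) = derived G (carrier G)"
proof -
  interpret group_hom G G \<phi> using assms by (rule auto_group_hom)
  show ?thesis using derived_img[of "carrier G"] autoD(3)[OF assms] by simp
qed

lemma (in group) auto_image_powers:
  assumes "\<phi> \<in> auto G"
  shows "\<phi> ` powers m G = powers m G"
proof -
  interpret group_hom G G \<phi> using assms by (rule auto_group_hom)
  have "\<phi> ` powers m G = (\<lambda>x. x [^] m) ` (\<phi> ` carrier G)"
    by (auto simp: powers_def image_image hom_nat_pow)
  then show ?thesis using autoD(3)[OF assms] by (simp add: powers_def)
qed

lemma (in comm_group) powers_normal: "powers m G \<lhd> G"
proof (rule subgroup_imp_normal)
  have "group_hom G G (\<lambda>x. x [^] m)"
    by unfold_locales (auto intro!: homI simp: pow_mult_distrib m_comm)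
  then show "subgroup (powers m G) G"
    unfolding powers_def by (rule group_hom.img_is_subgroup)
qed

context group
begin

lemma comm_group_abelianization: "comm_group (abelianization G)"
  unfolding abelianization_def by (rule derived_quot_is_comm_group)

lemma powers_abelianization_normal: "powers m (abelianization G) \<lhd> abelianization G"
  using comm_group_abelianization by (rule comm_group.powers_normal)

lemma abelianization_map:
  assumes "\<phi> \<in> auto G"
  shows "quotient_map G (derived G (carrier G)) \<phi> \<in> auto (abelianization G)"
  unfolding abelianization_def
  using derived_self_is_normal assms auto_image_derived[OF assms] by (rule normal.quotient_map_auto)

lemma abelianization_image_powers:
  assumes "\<phi> \<in> auto (abelianization G)"
  shows "\<phi> ` powers m (abelianization G) = powers m (abelianization G)"
proof -
  interpret A: comm_group "abelianization G" by (rule comm_group_abelianization)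
  show ?thesis using assms by (rule A.auto_image_powers)
qed

lemma H1_map_auto: "\<phi> \<in> auto G \<Longrightarrow> H1_map m G \<phi> \<in> auto (H1_mod m G)"
  unfolding H1_map_def H1_mod_def
  by (intro normal.quotient_map_auto powers_abelianization_normal abelianization_map
      abelianization_image_powers)

lemma H1_map_compose:
  assumes "\<phi> \<in> auto G" "\<psi> \<in> auto G"
  shows "H1_map m G (compose (carrier G) \<phi> \<psi>)
       = compose (carrier (H1_mod m G)) (H1_map m G \<phi>) (H1_map m G \<psi>)"
proof -
  have "quotient_map G (derived G (carrier G)) (compose (carrier G) \<phi> \<psi>)
      = compose (carrier (abelianization G)) (quotient_map G (derived G (carrier G)) \<phi>)
          (quotient_map G (derived G (carrier G)) \<psi>)"
    unfolding abelianization_def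
    using assms by (intro normal.quotient_map_compose derived_self_is_normal auto_image_derived)
  then show ?thesis
    unfolding H1_map_def H1_mod_def using assms
    by (simp only:) (intro normal.quotient_map_compose powers_abelianization_normal
        abelianization_map abelianization_image_powers)
qed

lemma H1_map_conjugation:
  assumes g: "g \<in> carrier G"
  shows "H1_map m G (conjugation G g) = (\<lambda>X \<in> carrier (H1_mod m G). X)"
proof -
  let ?D = "derived G (carrier G)"
  interpret D: normal ?D G by (rule derived_self_is_normal)
  interpret A: comm_group "abelianization G" by (rule comm_group_abelianization)
  interpret P: normal "powers m (abelianization G)" "abelianization G"
    by (rule powers_abelianization_normal)
  have im: "conjugation G g ` ?D = ?D" using g by (intro auto_image_derived conjugation_auto)
  have id: "quotient_map G ?D (conjugation G g) X = X" if X: "X \<in> carrier (abelianization G)" for X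
  proof -
    obtain x where x: "x \<in> carrier G" "X = ?D #> x"
      using X by (auto simp: abelianization_def carrier_FactGroup)
    have c: "(?D #> a) \<otimes>\<^bsub>abelianization G\<^esub> (?D #> b) = ?D #> (a \<otimes> b)"
      if "a \<in> carrier G" "b \<in> carrier G" for a b
      using D.rcos_sum[OF that] by (simp add: abelianization_def)
    have k: "?D #> a \<in> carrier (abelianization G)" if "a \<in> carrier G" for a
      using that by (auto simp: abelianization_def carrier_FactGroup)
    have "?D #> conjugation G g x
        = (?D #> (g \<otimes> x)) \<otimes>\<^bsub>abelianization G\<^esub> (?D #> inv g)"
      using g x by (simp add: conjugation_def c)
    also have "\<dots> = (?D #> inv g) \<otimes>\<^bsub>abelianization G\<^esub> (?D #> (g \<otimes> x))"
      using g x by (intro A.m_comm k) auto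
    also have "\<dots> = ?D #> (inv g \<otimes> (g \<otimes> x))" using g x by (intro c) auto
    also have "\<dots> = ?D #> x" using g x by (simp add: m_assoc[symmetric])
    finally show ?thesis
      using D.quotient_map_coset[OF conjugation_auto[OF g] im x(1)] x(2) by simp
  qed
  have "quotient_map G ?D (conjugation G g) ` X = X" if "X \<in> carrier (H1_mod m G)" for X
  proof -
    have "X \<subseteq> carrier (abelianization G)"
      using that P.subset A.r_coset_subset_G by (auto simp: H1_mod_def carrier_FactGroup)
    then show ?thesis using id by (auto simp: subset_iff image_iff)
  qed
  then show ?thesis
    by (auto simp: H1_map_def H1_mod_def quotient_map_def[of "abelianization G"] intro!: restrict_ext)
qed

theorem Out_H1_eq:
  assumes "\<phi> \<in> auto G"
  shows "Out_H1 m G (inner_auto G #>\<^bsub>AutoGroup G\<^esub> \<phi>) = H1_map m G \<phi>"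
  unfolding Out_H1_def
proof (rule the_elem_image_const)
  show "inner_auto G #>\<^bsub>AutoGroup G\<^esub> \<phi> \<noteq> {}"
    using assms one_closed by (simp add: inner_coset) blast
next
  fix \<psi> assume "\<psi> \<in> inner_auto G #>\<^bsub>AutoGroup G\<^esub> \<phi>"
  then obtain g where g: "g \<in> carrier G" "\<psi> = compose (carrier G) (conjugation G g) \<phi>"
    using assms by (auto simp: inner_coset)
  then have "H1_map m G \<psi>
      = compose (carrier (H1_mod m G)) (\<lambda>X \<in> carrier (H1_mod m G). X) (H1_map m G \<phi>)"
    using assms by (simp only: H1_map_compose conjugation_auto H1_map_conjugation)
  also have "\<dots> = H1_map m G \<phi>"
  proof (rule extensionalityI)
    show "H1_map m G \<phi> \<in> extensional (carrier (H1_mod m G))"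
      using H1_map_auto[OF assms] by (rule autoD)
  next
    fix X assume "X \<in> carrier (H1_mod m G)"
    then show "compose (carrier (H1_mod m G)) (\<lambda>X \<in> carrier (H1_mod m G). X) (H1_map m G \<phi>) X
        = H1_map m G \<phi> X"
      using autoD(5)[OF H1_map_auto[OF assms]] by (simp add: compose_def)
  qed (rule compose_extensional)
  finally show "H1_map m G \<psi> = H1_map m G \<phi>" .
qed

theorem Out_H1_hom: "Out_H1 m G \<in> hom (OutGroup G) (AutoGroup (H1_mod m G))"
proof (rule homI)
  fix x assume "x \<in> carrier (OutGroup G)"
  then show "Out_H1 m G x \<in> carrier (AutoGroup (H1_mod m G))"
    by (auto simp: carrier_OutGroup Out_H1_eq AutoGroup_simps H1_map_auto)
next
  fix x y assume "x \<in> carrier (OutGroup G)" "y \<in> carrier (OutGroup G)"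
  then obtain \<phi> \<psi> where *: "\<phi> \<in> auto G" "\<psi> \<in> auto G"
      "x = inner_auto G #>\<^bsub>AutoGroup G\<^esub> \<phi>" "y = inner_auto G #>\<^bsub>AutoGroup G\<^esub> \<psi>"
    by (auto simp: carrier_OutGroup)
  have "Out_H1 m G (x \<otimes>\<^bsub>OutGroup G\<^esub> y) = H1_map m G (compose (carrier G) \<phi> \<psi>)"
    unfolding *(3,4) using * by (simp only: OutGroup_mult Out_H1_eq compose_auto)
  also have "\<dots> = compose (carrier (H1_mod m G)) (H1_map m G \<phi>) (H1_map m G \<psi>)"
    using * by (intro H1_map_compose)
  also have "\<dots> = Out_H1 m G x \<otimes>\<^bsub>AutoGroup (H1_mod m G)\<^esub> Out_H1 m G y"
    unfolding *(3,4) using * by (simp only: AutoGroup_mult Out_H1_eq H1_map_auto)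
  finally show "Out_H1 m G (x \<otimes>\<^bsub>OutGroup G\<^esub> y)
      = Out_H1 m G x \<otimes>\<^bsub>AutoGroup (H1_mod m G)\<^esub> Out_H1 m G y" .
qed


subsection \<open>The action of outer automorphisms on conjugacy classes\<close>

lemma orbit_conjugation:
  "orbit G (conjugation G) x = (\<lambda>g. conjugation G g x) ` carrier G"
  by (auto simp: orbit_def)

lemma conj_classes_eq: "conj_classes G = orbit G (conjugation G) ` carrier G"
  by (auto simp: conj_classes_def orbits_def)

lemma auto_image_class:
  assumes "\<phi> \<in> auto G" "x \<in> carrier G"
  shows "\<phi> ` orbit G (conjugation G) x = orbit G (conjugation G) (\<phi> x)"
proof -
  have "\<phi> ` orbit G (conjugation G) x = (\<lambda>g. conjugation G g (\<phi> x)) ` (\<phi> ` carrier G)"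
    using assms by (simp add: orbit_conjugation image_image auto_conjugation cong: image_cong)
  then show ?thesis using assms by (simp add: autoD(3) orbit_conjugation)
qed

lemma conjugation_image_class:
  assumes g: "g \<in> carrier G" and c: "c \<in> conj_classes G"
  shows "conjugation G g ` c = c"
proof -
  obtain x where x: "x \<in> carrier G" and c: "c = orbit G (conjugation G) x"
    using c by (auto simp: conj_classes_eq)
  have "conjugation G g ` c = (\<lambda>h. conjugation G h x) ` ((\<lambda>h. g \<otimes> h) ` carrier G)"
    unfolding c orbit_conjugation image_image using g x
    by (intro image_cong) (auto simp: conjugation_def m_assoc inv_mult_group)
  also have "(\<lambda>h. g \<otimes> h) ` carrier G = carrier G" using g by (rule surj_const_mult)
  finally show ?thesis by (simp add: c orbit_conjugation)
qed

lemma conj_class_subset: "c \<in> conj_classes G \<Longrightarrow> c \<subseteq> carrier G"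
  by (auto simp: conj_classes_eq orbit_conjugation conjugation_def)

theorem Out_conj_eq:
  assumes "\<phi> \<in> auto G" and c: "c \<in> conj_classes G"
  shows "Out_conj G (inner_auto G #>\<^bsub>AutoGroup G\<^esub> \<phi>) c = \<phi> ` c"
proof -
  have "the_elem ((\<lambda>\<phi>. \<phi> ` c) ` (inner_auto G #>\<^bsub>AutoGroup G\<^esub> \<phi>)) = \<phi> ` c"
  proof (rule the_elem_image_const)
    show "inner_auto G #>\<^bsub>AutoGroup G\<^esub> \<phi> \<noteq> {}"
      using assms one_closed by (simp add: inner_coset) blast
  next
    fix \<psi> assume "\<psi> \<in> inner_auto G #>\<^bsub>AutoGroup G\<^esub> \<phi>"
    then obtain g where g: "g \<in> carrier G" "\<psi> = compose (carrier G) (conjugation G g) \<phi>"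
      using assms by (auto simp: inner_coset)
    have "\<psi> ` c = conjugation G g ` (\<phi> ` c)"
      unfolding g(2) image_image using conj_class_subset[OF c]
      by (intro image_cong) (auto simp: compose_def)
    moreover have "\<phi> ` c \<in> conj_classes G"
      using assms by (auto simp: conj_classes_eq auto_image_class autoD)
    ultimately show "\<psi> ` c = \<phi> ` c" using conjugation_image_class g(1) by simp
  qed
  then show ?thesis using c by (simp add: Out_conj_def)
qed

lemma auto_class_closed: "\<phi> \<in> auto G \<Longrightarrow> c \<in> conj_classes G \<Longrightarrow> \<phi> ` c \<in> conj_classes G"
  by (auto simp: conj_classes_eq auto_image_class autoD)

theorem Out_conj_action: "group_action (OutGroup G) (conj_classes G) (Out_conj G)"
proof -
  let ?C = "conj_classes G"
  have inj: "inj_on (Out_conj G (inner_auto G #>\<^bsub>AutoGroup G\<^esub> \<phi>)) ?C" if "\<phi> \<in> auto G" for \<phi>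
  proof (rule inj_onI)
    fix c d assume cd: "c \<in> ?C" "d \<in> ?C" "Out_conj G (inner_auto G #>\<^bsub>AutoGroup G\<^esub> \<phi>) c
        = Out_conj G (inner_auto G #>\<^bsub>AutoGroup G\<^esub> \<phi>) d"
    then have "\<phi> ` c = \<phi> ` d" using that by (simp only: Out_conj_eq)
    then show "c = d"
      using inj_on_image_eq_iff[OF autoD(4)[OF that]] conj_class_subset cd(1,2) by blast
  qed
  have img: "Out_conj G (inner_auto G #>\<^bsub>AutoGroup G\<^esub> \<phi>) ` ?C = ?C" if "\<phi> \<in> auto G" for \<phi>
  proof -
    have "Out_conj G (inner_auto G #>\<^bsub>AutoGroup G\<^esub> \<phi>) ` ?C = (\<lambda>c. \<phi> ` c) ` ?C"
      using that by (intro image_cong refl Out_conj_eq)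
    also have "\<dots> = orbit G (conjugation G) ` (\<phi> ` carrier G)"
      unfolding conj_classes_eq image_image using that by (intro image_cong refl auto_image_class)
    finally show ?thesis using autoD(3)[OF that] by (simp add: conj_classes_eq)
  qed
  have bij: "Out_conj G x \<in> Bij ?C" if x: "x \<in> carrier (OutGroup G)" for x
  proof -
    obtain \<phi> where \<phi>: "\<phi> \<in> auto G" "x = inner_auto G #>\<^bsub>AutoGroup G\<^esub> \<phi>"
      using x by (auto simp: carrier_OutGroup)
    have "Out_conj G x \<in> extensional ?C" by (simp add: Out_conj_def)
    then show ?thesis using inj[OF \<phi>(1)] img[OF \<phi>(1)] by (simp add: \<phi>(2) Bij_def bij_betw_def)
  qed
  have "Out_conj G \<in> hom (OutGroup G) (BijGroup ?C)"
  proof (rule homI)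
    fix x y assume xy: "x \<in> carrier (OutGroup G)" "y \<in> carrier (OutGroup G)"
    then obtain \<phi> \<psi> where *: "\<phi> \<in> auto G" "\<psi> \<in> auto G"
        "x = inner_auto G #>\<^bsub>AutoGroup G\<^esub> \<phi>" "y = inner_auto G #>\<^bsub>AutoGroup G\<^esub> \<psi>"
      by (auto simp: carrier_OutGroup)
    have "Out_conj G (x \<otimes>\<^bsub>OutGroup G\<^esub> y) = compose ?C (Out_conj G x) (Out_conj G y)"
    proof (rule extensionalityI)
      show "Out_conj G (x \<otimes>\<^bsub>OutGroup G\<^esub> y) \<in> extensional ?C" by (simp add: Out_conj_def)
      show "compose ?C (Out_conj G x) (Out_conj G y) \<in> extensional ?C" by (rule compose_extensional)
      fix c assume c: "c \<in> ?C"
      have "Out_conj G (x \<otimes>\<^bsub>OutGroup G\<^esub> y) c = compose (carrier G) \<phi> \<psi> ` c"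
        unfolding *(3,4) using * c by (simp only: OutGroup_mult Out_conj_eq compose_auto)
      also have "\<dots> = \<phi> ` (\<psi> ` c)"
        unfolding image_image using conj_class_subset[OF c]
        by (intro image_cong) (auto simp: compose_def)
      also have "\<dots> = Out_conj G x (Out_conj G y c)"
        unfolding *(3,4) using * c by (simp only: Out_conj_eq auto_class_closed)
      finally show "Out_conj G (x \<otimes>\<^bsub>OutGroup G\<^esub> y) c = compose ?C (Out_conj G x) (Out_conj G y) c"
        using c by (simp add: compose_def)
    qed
    then show "Out_conj G (x \<otimes>\<^bsub>OutGroup G\<^esub> y) = Out_conj G x \<otimes>\<^bsub>BijGroup ?C\<^esub> Out_conj G y"
      using bij xy by (simp add: BijGroup_def)
  qed (simp add: BijGroup_def bij)
  then show ?thesis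
    by (simp add: group_action_def group_hom_def group_hom_axioms_def group_OutGroup group_BijGroup)
qed

end

end

theory Submission
  imports Defs Complex_Main "HOL-Number_Theory.Cong"
begin

text \<open>Let \<open>\<theta>\<close> be represented by an automorphism \<open>\<phi>\<close> of the free group on \<open>S\<close>, and let \<open>\<phi>\<^sup>N u\<close> be
conjugate to \<open>u\<close>. The Magnus expansion sends a generator \<open>s\<close> to \<open>1 + X\<^sub>s\<close> in the ring of
integral power series in noncommuting variables. Summing its coefficients over all rotations of
a word \<open>w\<close> gives a class function, the cyclic trace at \<open>w\<close>. The theorem follows from two facts.

First, \<open>u\<close> and \<open>\<phi> u\<close> have the same cyclic traces (\<open>cyclic_trace_invariant\<close>). On the level of
power series, \<open>\<phi>\<close> substitutes for \<open>X\<^sub>s\<close> a series without constant term whose linear part is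
\<open>X\<^sub>s\<close> modulo 3. In the rescaled variables \<open>Y\<^sub>s = X\<^sub>s / 3\<close>, a term of degree \<open>d\<close> of this series
acquires the factor \<open>3\<^sup>d / 3\<close>, so that the substitution becomes the identity modulo 3. Hence the
\<open>m\<close>-th differences of the sequence \<open>k \<mapsto> 3\<^sup>l t(\<phi>\<^sup>k u)\<close>, where \<open>t\<close> is the trace at a word of length
\<open>l\<close>, are divisible by \<open>3\<^sup>m\<close>. The sequence is also periodic. A periodic sequence with such
differences is constant (\<open>three_adic_periodic_constant\<close>), for the same reason for which an
integral matrix of finite order that is the identity modulo 3 is the identity. The sequence
\<open>(-1)\<^sup>k\<close> shows that the prime 2 would not do.

Second, cyclic traces separate conjugacy classes
(\<open>cyclic_traces_separate_conjugacy_classes\<close>). Up to conjugacy, an element is a cyclically reduced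
product of powers \<open>s\<^sub>1\<^sup>a s\<^sub>2\<^sup>b \<dots>\<close> of generators with nonzero exponents. Its coefficient at a word
with the same number of syllables is zero unless the generators agree, and is then the product
of the binomial coefficients of the exponents over the lengths of the syllables; words with
more syllables have coefficient zero. So the cyclic trace at such a word is a sum of these products over the
rotations of the sequence of powers. The polynomials \<open>e choose m\<close> with \<open>m > 0\<close> span, over the
rationals, all polynomials that vanish at 0, and these separate nonzero integers. Therefore the
traces determine the sequence of powers up to rotation.\<close>

section \<open>Power series in noncommuting variables\<close>

text \<open>A function on words stands for the power series whose coefficients are its values. The recursion
on the word makes associativity and the compatibility with letters immediate inductions; the
usual sum over all splittings of the word is \<open>series_mult_eq_sum\<close>.\<close>

fun series_mult :: "('s list \<Rightarrow> int) \<Rightarrow> ('s list \<Rightarrow> int) \<Rightarrow> 's list \<Rightarrow> int" where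
  "series_mult f g [] = f [] * g []"
| "series_mult f g (t # w) = f [] * g (t # w) + series_mult (\<lambda>v. f (t # v)) g w"

definition series_one :: "'s list \<Rightarrow> int" where
  "series_one w = (if w = [] then 1 else 0)"

lemma series_mult_eq_sum:
  "series_mult f g w = (\<Sum>k\<le>length w. f (take k w) * g (drop k w))"
  by (induction f g w rule: series_mult.induct) (auto simp: sum.atMost_Suc_shift simp del: sum.atMost_Suc)

lemma series_mult_add_left:
  "series_mult (\<lambda>v. f v + f' v) g w = series_mult f g w + series_mult f' g w"
  by (simp add: series_mult_eq_sum sum.distrib algebra_simps)

lemma series_mult_scale_left: "series_mult (\<lambda>v. a * f v) g w = a * series_mult f g w"
  by (simp add: series_mult_eq_sum sum_distrib_left algebra_simps)

lemma series_mult_scale_right: "series_mult f (\<lambda>v. a * g v) w = a * series_mult f g w"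
  by (simp add: series_mult_eq_sum sum_distrib_left algebra_simps)

lemma series_mult_sum_right:
  "series_mult f (\<lambda>v. \<Sum>i\<in>I. g i v) w = (\<Sum>i\<in>I. series_mult f (g i) w)"
  by (simp add: series_mult_eq_sum sum_distrib_left sum.swap[of _ I])

lemma series_mult_zero_left: "series_mult (\<lambda>v. 0) g w = 0"
  by (simp add: series_mult_eq_sum)

lemma series_one_Cons: "(\<lambda>v. series_one (t # v)) = (\<lambda>v. 0)"
  by (auto simp: series_one_def)

lemma series_one_mult: "series_mult series_one g = g"
proof
  show "series_mult series_one g w = g w" for w
    by (cases w) (auto simp: series_one_Cons series_mult_zero_left series_one_def)
qed

lemma series_mult_assoc: "series_mult (series_mult f g) h = series_mult f (series_mult g h)"
proof
  show "series_mult (series_mult f g) h w = series_mult f (series_mult g h) w" for w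
    by (induction w arbitrary: f)
      (simp_all add: series_mult_add_left series_mult_scale_left algebra_simps)
qed

text \<open>The sum runs over rotation amounts and not over distinct rotated words: only this makes the
number of terms independent of the symmetries of \<open>w\<close>, as the reindexing below requires. Modulo
commutators a word depends only on its rotation class, so these sums are the natural traces on
the ring of power series.\<close>

definition cyclic_trace :: "('s list \<Rightarrow> int) \<Rightarrow> 's list \<Rightarrow> int" where
  "cyclic_trace f w = (\<Sum>k<length w. f (rotate k w))"

lemma sum_rotate_shift:
  fixes F :: "'s list \<Rightarrow> int"
  shows "(\<Sum>k<length w. F (rotate s (rotate k w))) = (\<Sum>k<length w. F (rotate k w))"
proof (induction s arbitrary: F)
  case (Suc s)
  have "(\<Sum>k<length w. F (rotate1 (rotate k w))) = (\<Sum>k<length w. F (rotate (Suc k) w))"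
    by simp
  also have "\<dots> = (\<Sum>k<length w. F (rotate k w))"
    using sum.lessThan_Suc_shift[of "\<lambda>k. F (rotate k w)" "length w"]
      sum.lessThan_Suc[of "\<lambda>k. F (rotate k w)" "length w"]
    by simp
  finally show ?case using Suc[of "\<lambda>v. F (rotate1 v)"] by simp
qed simp

text \<open>Splitting a rotation of \<open>w\<close> after \<open>s\<close> letters and exchanging the two parts is again a splitting
of a rotation of \<open>w\<close>, now after \<open>length w - s\<close> letters.\<close>

lemma cyclic_trace_mult_commute:
  "cyclic_trace (series_mult f g) w = cyclic_trace (series_mult g f) w"
proof -
  let ?n = "length w"
  have step: "(\<Sum>k<?n. f (take s (rotate k w)) * g (drop s (rotate k w)))
      = (\<Sum>k<?n. g (take (?n - s) (rotate k w)) * f (drop (?n - s) (rotate k w)))" if "s \<le> ?n" for s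
  proof -
    have "f (take s v) * g (drop s v)
        = g (take (?n - s) (rotate s v)) * f (drop (?n - s) (rotate s v))" if "length v = ?n" for v
      using that \<open>s \<le> ?n\<close> by (cases "s = ?n") (auto simp: rotate_drop_take)
    then have "(\<Sum>k<?n. f (take s (rotate k w)) * g (drop s (rotate k w)))
      = (\<Sum>k<?n. g (take (?n - s) (rotate s (rotate k w))) * f (drop (?n - s) (rotate s (rotate k w))))"
      by simp
    also have "\<dots> = (\<Sum>k<?n. g (take (?n - s) (rotate k w)) * f (drop (?n - s) (rotate k w)))"
      by (rule sum_rotate_shift)
    finally show ?thesis .
  qed
  have "cyclic_trace (series_mult f g) w
      = (\<Sum>s\<le>?n. \<Sum>k<?n. f (take s (rotate k w)) * g (drop s (rotate k w)))"
    by (simp add: cyclic_trace_def series_mult_eq_sum sum.swap[of _ "{..?n}"])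
  also have "\<dots> = (\<Sum>s\<le>?n. \<Sum>k<?n. g (take (?n - s) (rotate k w)) * f (drop (?n - s) (rotate k w)))"
    by (intro sum.cong refl step) simp
  also have "\<dots> = (\<Sum>s\<le>?n. \<Sum>k<?n. g (take s (rotate k w)) * f (drop s (rotate k w)))"
    by (rule sum.nat_diff_reindex[of _ "Suc ?n", simplified lessThan_Suc_atMost, simplified])
  also have "\<dots> = cyclic_trace (series_mult g f) w"
    by (simp add: cyclic_trace_def series_mult_eq_sum sum.swap[of _ "{..?n}"])
  finally show ?thesis .
qed


section \<open>The Magnus expansion\<close>

text \<open>Left multiplication by \<open>1 + X\<^sub>s\<close> and by its inverse. The second is computed from
\<open>g = f - X\<^sub>s g\<close>, where the right-hand side refers to \<open>g\<close> on shorter words only.\<close>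

fun letter_act :: "'s letter \<Rightarrow> ('s list \<Rightarrow> int) \<Rightarrow> 's list \<Rightarrow> int" where
  "letter_act a f [] = f []"
| "letter_act (s, True) f (t # w) = f (t # w) + (if t = s then f w else 0)"
| "letter_act (s, False) f (t # w) = f (t # w) - (if t = s then letter_act (s, False) f w else 0)"

text \<open>The expansion is defined on all words in the letters, reduced or not; free reduction does not
change it because the two actions of a generator are mutually inverse.\<close>

definition magnus :: "'s letter list \<Rightarrow> 's list \<Rightarrow> int" where
  "magnus u = foldr letter_act u series_one"

lemma magnus_Nil: "magnus [] = series_one"
  by (simp add: magnus_def)

lemma magnus_Cons: "magnus (a # u) = letter_act a (magnus u)"
  by (simp add: magnus_def)

lemma letter_act_inverse: "letter_act a (letter_act (letter_inv a) f) = f"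
proof
  obtain s b where a: "a = (s, b)" by (cases a)
  have "letter_act (s, True) (letter_act (s, False) f) w = f w" for w
    by (cases w) auto
  moreover have "letter_act (s, False) (letter_act (s, True) f) w = f w" for w
    by (induction w) auto
  ultimately show "letter_act a (letter_act (letter_inv a) f) w = f w" for w
    by (cases b) (auto simp: a letter_inv_def)
qed

lemma letter_act_mult: "letter_act a (series_mult f g) = series_mult (letter_act a f) g"
proof -
  obtain s b where a: "a = (s, b)" by (cases a)
  have pos: "letter_act (s, True) (series_mult f g) = series_mult (letter_act (s, True) f) g" for f
  proof
    show "letter_act (s, True) (series_mult f g) w = series_mult (letter_act (s, True) f) g w" for w
      by (cases w) (auto simp: series_mult_add_left series_mult_zero_left)
  qed
  \<comment> \<open>The inverse letter is treated by cancelling the action of the positive one.\<close>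
  have "letter_act (s, False) (series_mult f g)
      = letter_act (s, False) (series_mult (letter_act (s, True) (letter_act (s, False) f)) g)"
    using letter_act_inverse[of "(s, True)" f] by (simp add: letter_inv_def)
  also have "\<dots> = series_mult (letter_act (s, False) f) g"
    using letter_act_inverse[of "(s, False)"] by (simp add: pos[symmetric] letter_inv_def)
  finally show ?thesis using pos by (cases b) (auto simp: a)
qed

lemma magnus_append: "magnus (u @ v) = series_mult (magnus u) (magnus v)"
  by (induction u) (simp_all add: magnus_Nil magnus_Cons series_one_mult letter_act_mult)

lemma magnus_cons_red: "magnus (cons_red a u) = letter_act a (magnus u)"
  by (cases u) (auto simp: magnus_Cons letter_act_inverse)

lemma magnus_reduce: "magnus (reduce u) = magnus u"
  by (induction u) (auto simp: reduce_def magnus_cons_red magnus_Cons)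

lemma magnus_mult: "magnus (x \<otimes>\<^bsub>free_group S\<^esub> y) = series_mult (magnus x) (magnus y)"
  by (simp add: free_group_def magnus_reduce magnus_append)

lemma magnus_one: "magnus \<one>\<^bsub>free_group S\<^esub> = series_one"
  by (simp add: free_group_def magnus_Nil)

lemma magnus_at_Nil: "magnus u [] = 1"
  by (induction u) (simp_all add: magnus_Nil magnus_Cons series_one_def)

lemma cyclic_trace_conjugation:
  assumes "x \<in> carrier (free_group S)" "g \<in> carrier (free_group S)"
  shows "cyclic_trace (magnus (conjugation (free_group S) g x)) = cyclic_trace (magnus x)"
proof
  fix w
  let ?F = "free_group S"
  interpret F: group ?F by (rule group_free_group)
  have "cyclic_trace (magnus (conjugation ?F g x)) w
      = cyclic_trace (series_mult (magnus (inv\<^bsub>?F\<^esub> g)) (series_mult (magnus g) (magnus x))) w"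
    using assms by (simp add: conjugation_def magnus_mult cyclic_trace_mult_commute)
  also have "series_mult (magnus (inv\<^bsub>?F\<^esub> g)) (series_mult (magnus g) (magnus x))
      = magnus (inv\<^bsub>?F\<^esub> g \<otimes>\<^bsub>?F\<^esub> g \<otimes>\<^bsub>?F\<^esub> x)"
    by (simp add: magnus_mult series_mult_assoc)
  finally show "cyclic_trace (magnus (conjugation ?F g x)) w = cyclic_trace (magnus x) w"
    using assms by simp
qed

section \<open>Periodic sequences with small differences\<close>

definition diff_seq :: "(nat \<Rightarrow> int) \<Rightarrow> nat \<Rightarrow> int" where
  "diff_seq h k = h (Suc k) - h k"

text \<open>Sequences whose \<open>m\<close>-th differences are divisible by \<open>3\<^sup>m\<close>, scaled by \<open>3\<^sup>a\<close>. They form a module on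
which the difference operator is divisible by 3; this is the property of the shift that
Minkowski's argument uses.\<close>

definition three_adic :: "nat \<Rightarrow> (nat \<Rightarrow> int) \<Rightarrow> bool" where
  "three_adic a h \<longleftrightarrow> (\<forall>m k. 3 ^ (a + m) dvd (diff_seq ^^ m) h k)"

lemma diff_seq_funpow_add:
  "(diff_seq ^^ m) (\<lambda>k. h k + g k) k = (diff_seq ^^ m) h k + (diff_seq ^^ m) g k"
  by (induction m arbitrary: k) (simp_all add: diff_seq_def)

lemma diff_seq_funpow_scale: "(diff_seq ^^ m) (\<lambda>k. c * h k) k = c * (diff_seq ^^ m) h k"
  by (induction m arbitrary: k) (simp_all add: diff_seq_def algebra_simps)

lemma diff_seq_funpow_shift: "(diff_seq ^^ m) (\<lambda>k. h (k + n)) k = (diff_seq ^^ m) h (k + n)"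
  by (induction m arbitrary: k) (simp_all add: diff_seq_def)

lemma three_adic_add: "three_adic a h \<Longrightarrow> three_adic a g \<Longrightarrow> three_adic a (\<lambda>k. h k + g k)"
  by (simp add: three_adic_def diff_seq_funpow_add)

lemma three_adic_scale: "three_adic a h \<Longrightarrow> three_adic a (\<lambda>k. c * h k)"
  by (simp add: three_adic_def diff_seq_funpow_scale)

lemma three_adic_zero: "three_adic a (\<lambda>k. 0)"
  using diff_seq_funpow_scale[of _ 0 "\<lambda>k. 0"] by (simp add: three_adic_def)

lemma three_adic_sum:
  assumes "\<And>i. i \<in> I \<Longrightarrow> three_adic a (h i)"
  shows "three_adic a (\<lambda>k. \<Sum>i\<in>I. h i k)"
  using assms by (induction I rule: infinite_finite_induct) (auto intro: three_adic_zero three_adic_add)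

lemma three_adic_shift: "three_adic a h \<Longrightarrow> three_adic a (\<lambda>k. h (k + n))"
  by (simp add: three_adic_def diff_seq_funpow_shift)

lemma three_adic_scale_iff:
  assumes "\<not> 3 dvd q"
  shows "three_adic a (\<lambda>k. q * h k) \<longleftrightarrow> three_adic a h"
proof -
  have "coprime (3 ^ n) q" for n
    using assms prime_imp_coprime[of 3 q] by simp
  then have "3 ^ n dvd q * x \<longleftrightarrow> 3 ^ n dvd x" for n x
    by (rule coprime_dvd_mult_right_iff)
  then show ?thesis
    by (simp add: three_adic_def diff_seq_funpow_scale)
qed

lemma three_adic_triple_iff: "three_adic (Suc a) (\<lambda>k. 3 * h k) \<longleftrightarrow> three_adic a h"
  by (simp add: three_adic_def diff_seq_funpow_scale)

lemma three_adic_diff_seq: "three_adic a h \<Longrightarrow> three_adic (Suc a) (diff_seq h)"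
  unfolding three_adic_def by (metis add_Suc_shift funpow_Suc_right comp_apply)

text \<open>Telescoping writes the difference over \<open>n\<close> steps as a sum of \<open>n\<close> shifted simple differences.\<close>

lemma three_adic_shift_diff:
  assumes "three_adic a h"
  shows "three_adic (Suc a) (\<lambda>k. h (k + n) - h k)"
proof -
  have "three_adic (Suc a) (\<lambda>k. \<Sum>i<n. diff_seq h (k + i))"
    by (intro three_adic_sum three_adic_shift three_adic_diff_seq assms)
  moreover have "(\<Sum>i<n. diff_seq h (k + i)) = h (k + n) - h k" for k
    by (induction n) (auto simp: diff_seq_def)
  ultimately show ?thesis by simp
qed

text \<open>Let \<open>X\<close> be the shift by \<open>n\<close> minus the identity; it gains a factor 3. The hypothesis says that
\<open>(1 + (1 + X) + \<dots> + (1 + X)\<^sup>q\<^sup>-\<^sup>1) h = 0\<close>. All terms after \<open>q h\<close> contain \<open>X\<close>, so \<open>q h\<close> gains a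
factor 3, which suffices if \<open>q \<noteq> 3\<close>. If \<open>q = 3\<close>, the relation is \<open>3 h = - (3 X h + X\<^sup>2 h)\<close>, whose
right-hand side gains the factor 9.\<close>

lemma three_adic_prime_step:
  assumes h: "three_adic a h" and q: "prime q" and sum0: "\<And>k. (\<Sum>i<q. h (k + i * n)) = 0"
  shows "three_adic (Suc a) h"
proof (cases "q = 3")
  case False
  have "three_adic (Suc a) (\<lambda>k. \<Sum>i<q. (-1) * (h (k + i * n) - h k))"
    by (intro three_adic_sum three_adic_scale three_adic_shift_diff h)
  moreover have "(\<Sum>i<q. (-1) * (h (k + i * n) - h k)) = int q * h k" for k
    using sum0[of k] by (simp add: sum_subtractf)
  moreover have "\<not> 3 dvd int q"
  proof
    assume "3 dvd int q"
    then have "int 3 dvd int q" by simp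
    then have "3 dvd q" by (simp only: int_dvd_int_iff)
    then show False using False primes_dvd_imp_eq[OF _ q, of 3] by simp
  qed
  ultimately show ?thesis using three_adic_scale_iff by simp
next
  case True
  define X where "X = (\<lambda>g k. g (k + n) - (g k :: int))"
  have X: "three_adic (Suc b) (X g)" if "three_adic b g" for b g
    using three_adic_shift_diff[OF that] by (simp add: X_def)
  have "three_adic (Suc (Suc a)) (\<lambda>k. (-1) * (3 * X h k + X (X h) k))"
    using X[OF h] X[OF X[OF h]]
    by (intro three_adic_scale[of _ _ "-1"] three_adic_add three_adic_triple_iff[THEN iffD2])
  moreover have "(-1) * (3 * X h k + X (X h) k) = 3 * h k" for k
    using sum0[of k] by (simp add: True X_def eval_nat_numeral algebra_simps)
  ultimately show ?thesis by (simp add: three_adic_triple_iff)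
qed

lemma three_adic_all_zero:
  assumes "\<And>a. three_adic a h"
  shows "h k = 0"
proof (rule ccontr)
  assume "h k \<noteq> 0"
  moreover have "3 ^ nat \<bar>h k\<bar> dvd h k"
    using assms[of "nat \<bar>h k\<bar>"] unfolding three_adic_def by (metis add_0_right funpow_0)
  ultimately have "\<bar>(3::int) ^ nat \<bar>h k\<bar>\<bar> \<le> \<bar>h k\<bar>" by (rule dvd_imp_le_int)
  then have "(3::int) ^ nat \<bar>h k\<bar> \<le> \<bar>h k\<bar>" by simp
  moreover have "int (nat \<bar>h k\<bar>) < int (3 ^ nat \<bar>h k\<bar>)"
    by (subst of_nat_less_iff) (rule less_exp[THEN order.strict_trans2], simp add: power_mono)
  ultimately show False by simp
qed

text \<open>A period \<open>q n\<close> with \<open>q\<close> prime is reduced to the period \<open>n\<close>: the differences of \<open>h\<close> over \<open>n\<close> steps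
have sum zero over a full period, so by \<open>three_adic_prime_step\<close> they are divisible by every power
of 3.\<close>

theorem three_adic_periodic_constant:
  assumes h: "three_adic 0 h" and "N \<ge> 1" and "\<And>k. h (k + N) = h k"
  shows "h (k + 1) = h k"
  using assms(2,3)
proof (induction N arbitrary: k rule: less_induct)
  case (less N)
  show ?case
  proof (cases "N = 1")
    case False
    then obtain q where q: "prime q" "q dvd N" using prime_factor_nat by blast
    then obtain n where N: "N = q * n" by blast
    define g where "g k = h (k + n) - h k" for k
    have "(\<Sum>i<m. g (k + i * n)) = h (k + m * n) - h k" for k m
      by (induction m) (auto simp: g_def algebra_simps)
    then have sum0: "(\<Sum>i<q. g (k + i * n)) = 0" for k using less.prems(2) N by simp
    have "three_adic a g" for a
    proof (induction a)
      case 0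
      show ?case using three_adic_add[OF three_adic_shift[OF h, of n] three_adic_scale[OF h, of "-1"]]
        by (simp add: g_def)
    next
      case (Suc a)
      then show ?case using three_adic_prime_step q(1) sum0 by blast
    qed
    then have "g k = 0" for k by (rule three_adic_all_zero)
    then have "h (k + n) = h k" for k by (simp add: g_def)
    moreover have "n < N" "n \<ge> 1" using N less.prems(1) prime_gt_1_nat[OF q(1)] by auto
    ultimately show ?thesis using less.IH by blast
  qed (use less.prems in simp)
qed

section \<open>Endomorphisms that are trivial on homology modulo 3\<close>

text \<open>The coefficient of the one-letter word \<open>[t]\<close> is the exponent sum of \<open>t\<close>, so \<open>linear_part\<close> says
that \<open>\<phi>\<close> is the identity on the first homology modulo 3.\<close>

locale homology_trivial_endomorphism =
  fixes S :: "'s set" and \<phi> :: "'s letter list \<Rightarrow> 's letter list"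
  assumes finite_S: "finite S"
    and hom: "\<phi> \<in> hom (free_group S) (free_group S)"
    and linear_part: "\<And>s t. s \<in> S \<Longrightarrow> [magnus (\<phi> [(s, True)]) [t] = (if s = t then 1 else 0)] (mod 3)"
begin

abbreviation F where "F \<equiv> free_group S"

sublocale group_hom F F \<phi>
  using hom by (simp add: group_hom_def group_hom_axioms_def group_free_group)

text \<open>\<open>\<phi>\<close> acts on series by the substitution \<open>X\<^sub>s \<mapsto> gen_image s\<close>; the next functions are the resulting
images of monomials and of arbitrary series. The substituted series have no constant term, so
only the finitely many monomials of degree at most \<open>length w\<close> contribute to the coefficient at
\<open>w\<close>.\<close>

definition gen_image :: "'s \<Rightarrow> 's list \<Rightarrow> int" where
  "gen_image s w = (if w = [] then 0 else magnus (\<phi> [(s, True)]) w)"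

primrec monomial_image :: "'s list \<Rightarrow> 's list \<Rightarrow> int" where
  "monomial_image [] = series_one"
| "monomial_image (s # v) = series_mult (gen_image s) (monomial_image v)"

definition words :: "nat \<Rightarrow> 's list set" where
  "words n = {v. set v \<subseteq> S \<and> length v \<le> n}"

definition substitute :: "('s list \<Rightarrow> int) \<Rightarrow> 's list \<Rightarrow> int" where
  "substitute f w = (\<Sum>v\<in>words (length w). f v * monomial_image v w)"

lemma finite_words: "finite (words n)"
  unfolding words_def by (rule finite_lists_length_le[OF finite_S])

lemma monomial_image_zero: "length w < length v \<Longrightarrow> monomial_image v w = 0"
proof (induction v arbitrary: w)
  case (Cons s v)
  have "gen_image s (take k w) * monomial_image v (drop k w) = 0" if "k \<le> length w" for k
  proof (cases "k = 0")
    case False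
    then show ?thesis using Cons that by (cases w) auto
  qed (simp add: gen_image_def)
  then show ?case unfolding monomial_image.simps series_mult_eq_sum by (intro sum.neutral) simp
qed simp

text \<open>In the lowest possible degree only the linear parts of the substituted series contribute, and
these are the variables themselves modulo 3.\<close>

lemma monomial_image_diagonal:
  assumes "length v = length w" "set v \<subseteq> S"
  shows "[monomial_image v w = (if v = w then 1 else 0)] (mod 3)"
  using assms
proof (induction v w rule: list_induct2)
  case (Cons s v t w)
  have "gen_image s (t # take k w) * monomial_image v (drop k w)
      = (if k = 0 then gen_image s [t] * monomial_image v w else 0)" if "k \<le> length w" for k
    using that Cons.hyps by (cases w) (auto intro!: monomial_image_zero)
  then have "monomial_image (s # v) (t # w) = gen_image s [t] * monomial_image v w"
    by (simp add: series_mult_eq_sum sum.atMost_Suc_shift gen_image_def del: sum.atMost_Suc)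
  moreover have "[gen_image s [t] * monomial_image v w
      = (if s = t then 1 else 0) * (if v = w then 1 else 0)] (mod 3)"
    using linear_part[of s t] Cons by (intro cong_mult) (auto simp: gen_image_def)
  ultimately show ?case by (simp split: if_splits)
qed (simp add: series_one_def)

lemma substitute_bound:
  assumes "length w \<le> n"
  shows "(\<Sum>v\<in>words n. f v * monomial_image v w) = substitute f w"
  unfolding substitute_def using assms
  by (intro sum.mono_neutral_right finite_words) (auto simp: words_def intro!: monomial_image_zero)

text \<open>Multiplying a series by \<open>1 + X\<^sub>s\<close> before the substitution amounts to multiplying it by the
expansion of \<open>\<phi> s\<close> afterwards.\<close>

lemma substitute_generator:
  assumes "s \<in> S"
  shows "substitute (letter_act (s, True) f) = series_mult (magnus (\<phi> [(s, True)])) (substitute f)"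
proof
  fix w :: "'s list"
  let ?n = "length w"
  \<comment> \<open>The part of \<open>(1 + X\<^sub>s) f\<close> that comes from \<open>X\<^sub>s f\<close>. The bound is raised by one to make
    room for the longer monomials.\<close>
  define shifted where "shifted v = (case v of [] \<Rightarrow> 0 | t # u \<Rightarrow> if t = s then f u else 0)" for v
  have act: "letter_act (s, True) f v = f v + shifted v" for v
    by (cases v) (auto simp: shifted_def)
  have "substitute (letter_act (s, True) f) w
      = (\<Sum>v\<in>words (Suc ?n). (f v + shifted v) * monomial_image v w)"
    by (simp add: substitute_bound[symmetric, of w "Suc ?n"] act)
  also have "\<dots> = substitute f w + (\<Sum>v\<in>words (Suc ?n). shifted v * monomial_image v w)"
    by (simp add: distrib_right sum.distrib substitute_bound)
  also have "(\<Sum>v\<in>words (Suc ?n). shifted v * monomial_image v w)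
      = (\<Sum>v\<in>(#) s ` words ?n. shifted v * monomial_image v w)"
    using assms
    by (intro sum.mono_neutral_right finite_words) (auto simp: words_def shifted_def split: list.splits)
  also have "\<dots> = (\<Sum>v\<in>words ?n. f v * series_mult (gen_image s) (monomial_image v) w)"
    by (subst sum.reindex) (auto simp: shifted_def)
  also have "\<dots> = series_mult (gen_image s) (\<lambda>u. \<Sum>v\<in>words ?n. f v * monomial_image v u) w"
    by (simp add: series_mult_sum_right series_mult_scale_right)
  also have "\<dots> = series_mult (gen_image s) (substitute f) w"
    unfolding series_mult_eq_sum by (intro sum.cong refl) (simp add: substitute_bound)
  finally have "substitute (letter_act (s, True) f) w
      = series_mult (\<lambda>u. series_one u + gen_image s u) (substitute f) w"
    by (simp add: series_mult_add_left series_one_mult)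
  moreover have "(\<lambda>u. series_one u + gen_image s u) = magnus (\<phi> [(s, True)])"
    by (auto simp: series_one_def gen_image_def magnus_at_Nil)
  ultimately show "substitute (letter_act (s, True) f) w
      = series_mult (magnus (\<phi> [(s, True)])) (substitute f) w" by simp
qed

text \<open>Induction on the reduced word. Positive letters are \<open>substitute_generator\<close>; negative letters
follow from it by cancelling the invertible expansion of \<open>\<phi> s\<close>.\<close>

lemma magnus_hom_image: "u \<in> carrier F \<Longrightarrow> magnus (\<phi> u) = substitute (magnus u)"
proof (induction u)
  case Nil
  have "substitute (magnus []) w = series_one w" for w
  proof -
    have "substitute (magnus []) w = (\<Sum>v\<in>{[]}. series_one v * monomial_image v w)"
      unfolding substitute_def magnus_Nil
      by (intro sum.mono_neutral_right finite_words) (auto simp: words_def series_one_def)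
    then show ?thesis by (simp add: series_one_def)
  qed
  moreover have "\<phi> [] = []" using hom_one by (simp add: free_group_def)
  ultimately show ?case by (auto simp: magnus_Nil)
next
  case (Cons a u)
  obtain s b where a: "a = (s, b)" by (cases a)
  have u: "u \<in> carrier F" and s: "s \<in> S" and r: "reduced (a # u)"
    using Cons.prems by (auto simp: free_group_def a dest: reduced_ConsD)
  have g: "[(s, c)] \<in> carrier F" for c using s by (rule generator_in_free_group)
  have "a # u = [(s, b)] \<otimes>\<^bsub>F\<^esub> u"
    using reduce_reduced[OF r] by (simp add: free_group_def a)
  then have *: "magnus (\<phi> (a # u)) = series_mult (magnus (\<phi> [(s, b)])) (substitute (magnus u))"
    using u g Cons.IH by (simp add: magnus_mult)
  show ?case
  proof (cases b)
    case True
    then show ?thesis using * s by (simp add: substitute_generator magnus_Cons a)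
  next
    case False
    let ?g = "letter_act (s, False) (magnus u)"
    have "magnus u = letter_act (s, True) ?g"
      using letter_act_inverse[of "(s, True)"] by (simp add: letter_inv_def)
    then have "substitute (magnus u) = series_mult (magnus (\<phi> [(s, True)])) (substitute ?g)"
      using substitute_generator[OF s] by metis
    then have "magnus (\<phi> (a # u))
        = series_mult (magnus (\<phi> ([(s, False)] \<otimes>\<^bsub>F\<^esub> [(s, True)]))) (substitute ?g)"
      using * False g by (simp add: magnus_mult series_mult_assoc)
    also have "[(s, False)] \<otimes>\<^bsub>F\<^esub> [(s, True)] = \<one>\<^bsub>F\<^esub>"
      by (simp add: free_group_def reduce_def letter_inv_def)
    finally show ?thesis using False by (simp add: a magnus_Cons magnus_one series_one_mult)
  qed
qed

text \<open>The substitution in the variables \<open>Y\<^sub>s = X\<^sub>s / 3\<close>: the coefficient at \<open>v\<close> of a series in the \<open>X\<^sub>s\<close>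
becomes \<open>3\<^sup>l\<close> times itself, where \<open>l = length v\<close>. No exponent is negative since monomials
only contribute to words that are at least as long.\<close>

definition scaled_substitute :: "('s list \<Rightarrow> int) \<Rightarrow> 's list \<Rightarrow> int" where
  "scaled_substitute f w =
    (\<Sum>v\<in>words (length w). f v * (3 ^ (length w - length v) * monomial_image v w))"

lemma scaled_substitute_cong:
  assumes "\<And>v. set v \<subseteq> S \<Longrightarrow> f v = g v"
  shows "scaled_substitute f w = scaled_substitute g w"
  unfolding scaled_substitute_def using assms by (intro sum.cong) (auto simp: words_def)

text \<open>Shorter monomials carry a positive power of 3, and monomials of the same length are governed by
\<open>monomial_image_diagonal\<close>.\<close>

lemma scaled_substitute_near_identity:
  assumes "set w \<subseteq> S"
  shows "3 dvd scaled_substitute f w - f w"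
proof -
  let ?c = "\<lambda>v. 3 ^ (length w - length v) * monomial_image v w - (if v = w then 1 else 0)"
  have "f w = (\<Sum>v\<in>words (length w). f v * (if v = w then 1 else 0))"
    using assms finite_words by (simp add: if_distrib sum.delta words_def cong: if_cong)
  then have "scaled_substitute f w - f w = (\<Sum>v\<in>words (length w). f v * ?c v)"
    by (simp add: scaled_substitute_def right_diff_distrib sum_subtractf)
  also have "3 dvd \<dots>"
  proof (rule dvd_sum)
    fix v assume v: "v \<in> words (length w)"
    have "3 dvd ?c v"
    proof (cases "length v = length w")
      case True
      then show ?thesis
        using v monomial_image_diagonal[of v w] by (simp add: words_def cong_iff_dvd_diff)
    next
      case False
      then have "length v < length w" using v by (simp add: words_def)
      then show ?thesis by (auto intro!: dvd_mult2)
    qed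
    then show "3 dvd f v * ?c v" by simp
  qed
  finally show ?thesis .
qed

text \<open>Writing the substitution as \<open>1 + 3 R\<close> with a linear operator \<open>R\<close> that commutes with it, the
difference of \<open>k \<mapsto> (1 + 3 R)\<^sup>k f\<close> is 3 times the sequence of the same kind starting with \<open>R f\<close>.\<close>

lemma scaled_substitute_iterate_three_adic:
  assumes "set w \<subseteq> S"
  shows "three_adic 0 (\<lambda>k. (scaled_substitute ^^ k) f w)"
proof -
  have "3 ^ m dvd (diff_seq ^^ m) (\<lambda>k. (scaled_substitute ^^ k) f w) k" for m k
  proof (induction m arbitrary: f k)
    case (Suc m)
    \<comment> \<open>The operator \<open>R\<close> above, applied to \<open>f\<close>. The division is exact only at words over \<open>S\<close>, and only
    these matter.\<close>
    define f' where "f' v = (scaled_substitute f v - f v) div 3" for v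
    have step: "(scaled_substitute ^^ Suc k) f w - (scaled_substitute ^^ k) f w
        = 3 * (scaled_substitute ^^ k) f' w" if "set w \<subseteq> S" for k w
      using that
    proof (induction k arbitrary: w)
      case 0
      then show ?case using scaled_substitute_near_identity by (simp add: f'_def)
    next
      case (Suc k)
      let ?f = "\<lambda>j. (scaled_substitute ^^ j) f"
      have "scaled_substitute (?f (Suc k)) w - scaled_substitute (?f k) w
          = scaled_substitute (\<lambda>v. ?f (Suc k) v - ?f k v) w"
        by (simp add: scaled_substitute_def sum_subtractf left_diff_distrib)
      also have "\<dots> = scaled_substitute (\<lambda>v. 3 * (scaled_substitute ^^ k) f' v) w"
        by (rule scaled_substitute_cong) (rule Suc.IH)
      also have "\<dots> = 3 * scaled_substitute ((scaled_substitute ^^ k) f') w"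
        by (simp add: scaled_substitute_def sum_distrib_left mult.assoc)
      finally show ?case by simp
    qed
    have "diff_seq (\<lambda>k. (scaled_substitute ^^ k) f w) = (\<lambda>k. 3 * (scaled_substitute ^^ k) f' w)"
      using step[OF assms] unfolding diff_seq_def by blast
    then have "(diff_seq ^^ Suc m) (\<lambda>k. (scaled_substitute ^^ k) f w) k
        = 3 * (diff_seq ^^ m) (\<lambda>k. (scaled_substitute ^^ k) f' w) k"
      by (simp only: funpow_Suc_right comp_apply diff_seq_funpow_scale)
    then show ?case using Suc[of f' k] by simp
  qed simp
  then show ?thesis by (simp add: three_adic_def)
qed

lemma iterate_closed: "u \<in> carrier F \<Longrightarrow> (\<phi> ^^ k) u \<in> carrier F"
  by (induction k) auto

lemma magnus_iterate:
  assumes "u \<in> carrier F" "set w \<subseteq> S"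
  shows "(scaled_substitute ^^ k) (\<lambda>v. 3 ^ length v * magnus u v) w
    = 3 ^ length w * magnus ((\<phi> ^^ k) u) w"
  using assms(2)
proof (induction k arbitrary: w)
  case (Suc k)
  have "(scaled_substitute ^^ Suc k) (\<lambda>v. 3 ^ length v * magnus u v) w
      = scaled_substitute (\<lambda>v. 3 ^ length v * magnus ((\<phi> ^^ k) u) v) w"
    using Suc.IH by (auto intro: scaled_substitute_cong)
  also have "\<dots> = 3 ^ length w * substitute (magnus ((\<phi> ^^ k) u)) w"
    unfolding scaled_substitute_def substitute_def sum_distrib_left
  proof (rule sum.cong)
    fix v assume "v \<in> words (length w)"
    then have "(3::int) ^ length w = 3 ^ length v * 3 ^ (length w - length v)"
      by (simp add: words_def flip: power_add)
    then show "3 ^ length v * magnus ((\<phi> ^^ k) u) v * (3 ^ (length w - length v) * monomial_image v w)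
        = 3 ^ length w * (magnus ((\<phi> ^^ k) u) v * monomial_image v w)" by simp
  qed simp
  finally show ?case using magnus_hom_image[OF iterate_closed[OF assms(1), of k]] by simp
qed simp

text \<open>Along the orbit of \<open>u\<close> under \<open>\<phi>\<close> the cyclic trace, multiplied by \<open>3\<^sup>l\<close> for \<open>l = length w\<close>, has
3-adically small differences by the lemmas above, and period \<open>N\<close> because it is a class function.\<close>

theorem cyclic_trace_invariant:
  assumes u: "u \<in> carrier F" and w: "set w \<subseteq> S"
    and "N \<ge> 1" "g \<in> carrier F" "(\<phi> ^^ N) u = conjugation F g u"
  shows "cyclic_trace (magnus (\<phi> u)) w = cyclic_trace (magnus u) w"
proof -
  let ?h = "\<lambda>k. 3 ^ length w * cyclic_trace (magnus ((\<phi> ^^ k) u)) w"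
  have "three_adic 0 (\<lambda>k. \<Sum>j<length w. 3 ^ length w * magnus ((\<phi> ^^ k) u) (rotate j w))"
  proof (rule three_adic_sum)
    fix j
    have "set (rotate j w) \<subseteq> S" using w by simp
    from scaled_substitute_iterate_three_adic[OF this] magnus_iterate[OF u this]
    show "three_adic 0 (\<lambda>k. 3 ^ length w * magnus ((\<phi> ^^ k) u) (rotate j w))"
      by (metis (no_types, lifting) ext length_rotate)
  qed
  then have "three_adic 0 ?h" by (simp add: cyclic_trace_def sum_distrib_left)
  moreover have "?h (k + N) = ?h k" for k
  proof -
    have "(\<phi> ^^ k) (conjugation F g u) = conjugation F ((\<phi> ^^ k) g) ((\<phi> ^^ k) u)"
      using u assms(4) by (induction k) (auto simp: conjugation_def iterate_closed)
    then have "(\<phi> ^^ (k + N)) u = conjugation F ((\<phi> ^^ k) g) ((\<phi> ^^ k) u)"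
      by (simp add: funpow_add assms(5))
    then show ?thesis
      using u assms(4) by (simp add: cyclic_trace_conjugation iterate_closed)
  qed
  ultimately have "?h (0 + 1) = ?h 0"
    using \<open>N \<ge> 1\<close> by (intro three_adic_periodic_constant[where N = N])
  then show ?thesis by simp
qed

end

section \<open>Cyclically reduced products of powers\<close>

definition conjugate_in :: "('a, 'b) monoid_scheme \<Rightarrow> 'a \<Rightarrow> 'a \<Rightarrow> bool" where
  "conjugate_in G x y \<longleftrightarrow> (\<exists>g \<in> carrier G. y = conjugation G g x)"

context group
begin

lemma conjugate_in_refl: "x \<in> carrier G \<Longrightarrow> conjugate_in G x x"
  unfolding conjugate_in_def conjugation_def by (rule bexI[of _ \<one>]) auto

lemma conjugate_in_sym:
  assumes "x \<in> carrier G" "conjugate_in G x y"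
  shows "conjugate_in G y x"
proof -
  obtain g where g: "g \<in> carrier G" "y = conjugation G g x"
    using assms(2) unfolding conjugate_in_def by blast
  have "inv g \<otimes> (g \<otimes> x \<otimes> inv g) \<otimes> inv (inv g) = (inv g \<otimes> g) \<otimes> x \<otimes> (inv g \<otimes> g)"
    using g(1) assms(1) by (simp only: m_assoc inv_inv m_closed inv_closed)
  then have "x = conjugation G (inv g) y"
    using g assms(1) by (simp add: conjugation_def)
  then show ?thesis using g(1) unfolding conjugate_in_def by blast
qed

lemma conjugate_in_trans:
  assumes "x \<in> carrier G" "conjugate_in G x y" "conjugate_in G y z"
  shows "conjugate_in G x z"
proof -
  obtain g h where gh: "g \<in> carrier G" "h \<in> carrier G"
    "y = conjugation G g x" "z = conjugation G h y"
    using assms unfolding conjugate_in_def by blast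
  then have "z = conjugation G (h \<otimes> g) x"
    using assms(1) by (simp add: conjugation_def m_assoc inv_mult_group)
  then show ?thesis using gh unfolding conjugate_in_def by blast
qed

lemma conjugate_in_mult_commute:
  assumes "x \<in> carrier G" "y \<in> carrier G"
  shows "conjugate_in G (x \<otimes> y) (y \<otimes> x)"
  unfolding conjugate_in_def
  using assms by (intro bexI[of _ "inv x"]) (auto simp: conjugation_def m_assoc[symmetric])

end

fun syllable_product :: "'s set \<Rightarrow> ('s \<times> int) list \<Rightarrow> 's letter list" where
  "syllable_product S [] = \<one>\<^bsub>free_group S\<^esub>"
| "syllable_product S ((s, e) # cs) =
    [(s, True)] [^]\<^bsub>free_group S\<^esub> e \<otimes>\<^bsub>free_group S\<^esub> syllable_product S cs"

lemma syllable_product_closed: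
  "fst ` set cs \<subseteq> S \<Longrightarrow> syllable_product S cs \<in> carrier (free_group S)"
proof (induction cs)
  case Nil
  interpret group "free_group S" by (rule group_free_group)
  show ?case by simp
next
  case (Cons c cs)
  interpret group "free_group S" by (rule group_free_group)
  show ?case using Cons by (cases c) (auto simp: generator_in_free_group)
qed

lemma syllable_product_append:
  assumes "fst ` set cs \<subseteq> S" "fst ` set ds \<subseteq> S"
  shows "syllable_product S (cs @ ds)
    = syllable_product S cs \<otimes>\<^bsub>free_group S\<^esub> syllable_product S ds"
  using assms(1)
proof (induction cs)
  case (Cons c cs)
  interpret group "free_group S" by (rule group_free_group)
  show ?case
    using Cons syllable_product_closed[of cs S] syllable_product_closed[of ds S] assms(2)
      generator_in_free_group[of "fst c" S True]
    by (cases c) (auto simp: m_assoc)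
next
  case Nil
  interpret group "free_group S" by (rule group_free_group)
  show ?case using syllable_product_closed[of ds S] assms(2) by simp
qed

lemma conjugate_syllable_product_swap:
  assumes "fst ` set cs \<subseteq> S" "fst ` set ds \<subseteq> S"
  shows "conjugate_in (free_group S) (syllable_product S (cs @ ds)) (syllable_product S (ds @ cs))"
  unfolding syllable_product_append[OF assms] syllable_product_append[OF assms(2,1)]
  by (intro group.conjugate_in_mult_commute group_free_group syllable_product_closed assms)

lemma conjugate_syllable_product_rotate:
  assumes "fst ` set cs \<subseteq> S"
  shows "conjugate_in (free_group S) (syllable_product S cs) (syllable_product S (rotate i cs))"
proof -
  let ?n = "i mod length cs"
  have "fst ` set (take ?n cs) \<subseteq> S" "fst ` set (drop ?n cs) \<subseteq> S"
    using assms set_take_subset[of ?n cs] set_drop_subset[of ?n cs] by blast+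
  from conjugate_syllable_product_swap[OF this] show ?thesis by (simp add: rotate_drop_take)
qed

lemma inverse_generator:
  "s \<in> S \<Longrightarrow> inv\<^bsub>free_group S\<^esub> [(s, True)] = [(s, False)]"
proof -
  assume s: "s \<in> S"
  interpret group "free_group S" by (rule group_free_group)
  have "[(s, False)] \<otimes>\<^bsub>free_group S\<^esub> [(s, True)] = \<one>\<^bsub>free_group S\<^esub>"
    by (simp add: free_group_def reduce_def letter_inv_def)
  then show ?thesis using s by (simp add: inv_equality generator_in_free_group)
qed

lemma carrier_is_syllable_product:
  assumes "u \<in> carrier (free_group S)"
  shows "\<exists>cs. fst ` set cs \<subseteq> S \<and> u = syllable_product S cs"
  using assms
proof (induction u)
  case Nil
  show ?case by (intro exI[of _ "[]"]) (simp add: free_group_def)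
next
  case (Cons a u)
  interpret group "free_group S" by (rule group_free_group)
  obtain s b where a: "a = (s, b)" by (cases a)
  have u: "u \<in> carrier (free_group S)" and s: "s \<in> S" and r: "reduced (a # u)"
    using Cons.prems by (auto simp: free_group_def a dest: reduced_ConsD)
  obtain cs where cs: "fst ` set cs \<subseteq> S" "u = syllable_product S cs" using Cons.IH[OF u] by blast
  have "[(s, b)] = [(s, True)] [^]\<^bsub>free_group S\<^esub> (if b then 1 else -1 :: int)"
    using s by (simp add: int_pow_neg generator_in_free_group inverse_generator)
  moreover have "a # u = [(s, b)] \<otimes>\<^bsub>free_group S\<^esub> u"
    using reduce_reduced[OF r] by (simp add: free_group_def a)
  ultimately have "a # u = syllable_product S ((s, if b then 1 else -1) # cs)"
    using cs by simp
  then show ?case using cs s by (intro exI[of _ "(s, if b then 1 else -1) # cs"]) auto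
qed

text \<open>Appending the first generator at the end expresses that neighbours are distinct also around the
end of the list. A list of length one would never satisfy this, hence the separate case.\<close>

definition cyclically_reduced :: "('s \<times> int) list \<Rightarrow> bool" where
  "cyclically_reduced cs \<longleftrightarrow> 0 \<notin> snd ` set cs
    \<and> (length cs \<le> 1 \<or> distinct_adj (map fst cs @ [hd (map fst cs)]))"

lemma not_distinct_adjD: "\<not> distinct_adj xs \<Longrightarrow> \<exists>us a vs. xs = us @ a # a # vs"
proof (induction xs rule: induct_list012)
  case (3 x y zs)
  show ?case
  proof (cases "x = y")
    case True
    then show ?thesis by (intro exI[of _ "[]"]) auto
  next
    case False
    then obtain us a vs where "y # zs = us @ a # a # vs" using 3 by auto
    then show ?thesis by (intro exI[of _ "x # us"]) auto
  qed
qed auto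

lemma not_cyclically_distinct_rotate:
  assumes "length xs > 1" "\<not> distinct_adj (xs @ [hd xs])"
  shows "\<exists>i a ys. rotate i xs = a # a # ys"
proof -
  obtain us a vs where eq: "xs @ [hd xs] = us @ a # a # vs"
    using not_distinct_adjD[OF assms(2)] by blast
  show ?thesis
  proof (cases vs rule: rev_cases)
    case Nil
    then have xs: "xs = us @ [a]" "hd xs = a" using eq by auto
    then obtain us' where us': "us = a # us'" using assms(1) by (cases us) auto
    have "rotate (length us) (us @ [a]) = [a] @ us" by (rule rotate_append)
    then have "rotate (length us) xs = a # a # us'" by (simp only: xs us' append_Cons append_Nil)
    then show ?thesis by blast
  next
    case (snoc vs' b)
    then have "xs = us @ a # a # vs'" using eq by auto
    then have "rotate (length us) xs = a # a # (vs' @ us)" by (simp add: rotate_append)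
    then show ?thesis by blast
  qed
qed

text \<open>As long as the list is not cyclically reduced it can be shortened: a trivial power is dropped,
and two cyclically adjacent powers of the same generator are rotated to the front and merged.\<close>

lemma conjugate_to_cyclically_reduced:
  assumes "fst ` set cs \<subseteq> S"
  shows "\<exists>ds. fst ` set ds \<subseteq> S \<and> cyclically_reduced ds
    \<and> conjugate_in (free_group S) (syllable_product S cs) (syllable_product S ds)"
  using assms
proof (induction cs rule: length_induct)
  case (1 cs)
  interpret group "free_group S" by (rule group_free_group)
  have shorter: ?case if ds: "length ds < length cs" "fst ` set ds \<subseteq> S"
    "conjugate_in (free_group S) (syllable_product S cs) (syllable_product S ds)" for ds
  proof -
    obtain es where "fst ` set es \<subseteq> S" "cyclically_reduced es"
      "conjugate_in (free_group S) (syllable_product S ds) (syllable_product S es)"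
      using "1.IH" ds(1,2) by blast
    then show ?thesis
      using conjugate_in_trans[OF syllable_product_closed[OF "1.prems"] ds(3)] by blast
  qed
  consider "cyclically_reduced cs" | "0 \<in> snd ` set cs"
    | "length cs > 1" "\<not> distinct_adj (map fst cs @ [hd (map fst cs)])"
    by (meson cyclically_reduced_def not_le)
  then show ?case
  proof cases
    case 1
    then show ?thesis using "1.prems" conjugate_in_refl syllable_product_closed by blast
  next
    case 2
    then obtain s where "(s, 0) \<in> set cs" by auto
    then obtain xs ys where cs: "cs = xs @ (s, 0) # ys" by (meson split_list)
    have S: "s \<in> S" "fst ` set xs \<subseteq> S" "fst ` set ys \<subseteq> S" using "1.prems" by (auto simp: cs)
    have "syllable_product S cs = syllable_product S (xs @ ys)"
      using S by (simp add: cs syllable_product_append syllable_product_closed)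
    moreover have closed: "fst ` set (xs @ ys) \<subseteq> S" using S by (simp add: image_Un)
    ultimately show ?thesis
      using shorter[OF _ closed] conjugate_in_refl[OF syllable_product_closed[OF closed]] by (simp add: cs)
  next
    case 3
    have "\<exists>i s ys. rotate i (map fst cs) = s # s # ys"
      by (rule not_cyclically_distinct_rotate) (use 3 in simp_all)
    then obtain i s ys where "rotate i (map fst cs) = s # s # ys"
      by (elim exE) (rule that)
    then have "map fst (rotate i cs) = s # s # ys" by (simp add: rotate_map)
    then obtain e f zs where rot: "rotate i cs = (s, e) # (s, f) # zs"
      by (auto simp: map_eq_Cons_conv)
    have "fst ` set (rotate i cs) \<subseteq> S" using "1.prems" by simp
    then have S: "s \<in> S" "fst ` set zs \<subseteq> S" by (auto simp: rot)
    have "length cs = length (rotate i cs)" by simp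
    then have len: "length cs = Suc (Suc (length zs))" by (simp add: rot)
    have "syllable_product S (rotate i cs) = syllable_product S ((s, e + f) # zs)"
      using S by (simp add: rot int_pow_mult m_assoc generator_in_free_group syllable_product_closed)
    then show ?thesis
      using shorter[of "(s, e + f) # zs"] S len
        conjugate_syllable_product_rotate[OF "1.prems", of i] by auto
  qed
qed

section \<open>Magnus coefficients of products of powers\<close>

text \<open>The binomial coefficient of a possibly negative integer; it is an integer, so the floor only
changes the type.\<close>

definition int_choose :: "int \<Rightarrow> nat \<Rightarrow> int" where
  "int_choose e m = floor (real_of_int e gchoose m)"

lemma of_int_int_choose: "real_of_int (int_choose e m) = real_of_int e gchoose m"
  unfolding int_choose_def of_int_gbinomial[symmetric] by (simp only: floor_of_int)

lemma int_choose_0 [simp]: "int_choose e 0 = 1"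
  by (simp add: int_choose_def)

lemma int_choose_0_left: "m > 0 \<Longrightarrow> int_choose 0 m = 0"
  by (cases m) (simp_all add: int_choose_def)

lemma int_choose_1 [simp]: "int_choose e (Suc 0) = e"
  by (simp add: int_choose_def flip: One_nat_def)

lemma int_choose_Suc: "int_choose (e + 1) (Suc m) = int_choose e m + int_choose e (Suc m)"
proof -
  have "real_of_int (int_choose (e + 1) (Suc m)) = real_of_int (int_choose e m + int_choose e (Suc m))"
    by (simp only: of_int_add of_int_int_choose of_int_1 gbinomial_Suc_Suc)
  then show ?thesis by (simp only: of_int_eq_iff)
qed

lemma int_choose_absorb:
  "e * int_choose e m = int m * int_choose e m + int (Suc m) * int_choose e (Suc m)"
proof -
  have "real_of_int (e * int_choose e m)
      = real_of_int (int m * int_choose e m + int (Suc m) * int_choose e (Suc m))"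
    by (simp only: of_int_add of_int_mult of_int_int_choose of_int_of_nat_eq gbinomial_mult_1)
  then show ?thesis by (simp only: of_int_eq_iff)
qed

text \<open>The series \<open>(1 + X\<^sub>s)\<^sup>e\<close>.\<close>

definition binomial_series :: "'s \<Rightarrow> int \<Rightarrow> 's list \<Rightarrow> int" where
  "binomial_series s e w = (if set w \<subseteq> {s} then int_choose e (length w) else 0)"

lemma letter_act_binomial_series:
  "letter_act (s, True) (binomial_series s e) = binomial_series s (e + 1)"
proof
  show "letter_act (s, True) (binomial_series s e) w = binomial_series s (e + 1) w" for w
    by (cases w) (auto simp: binomial_series_def int_choose_Suc)
qed

lemma magnus_letter_mult: "magnus ([a] \<otimes>\<^bsub>free_group S\<^esub> x) = letter_act a (magnus x)"
  by (simp add: free_group_def magnus_reduce magnus_Cons)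

lemma magnus_generator_power:
  assumes s: "s \<in> S"
  shows "magnus ([(s, True)] [^]\<^bsub>free_group S\<^esub> (e::int)) = binomial_series s e"
proof (induction e rule: int_induct[where k = 0])
  case base
  have "series_one w = binomial_series s 0 w" for w
    by (cases w) (auto simp: series_one_def binomial_series_def int_choose_0_left)
  then show ?case using magnus_one[of S] by (auto simp: fun_eq_iff)
next
  case (step1 e)
  interpret group "free_group S" by (rule group_free_group)
  have g: "[(s, True)] \<in> carrier (free_group S)" using s by (rule generator_in_free_group)
  have "[(s, True)] [^]\<^bsub>free_group S\<^esub> (e + 1)
      = [(s, True)] \<otimes>\<^bsub>free_group S\<^esub> [(s, True)] [^]\<^bsub>free_group S\<^esub> e"
    using int_pow_mult[OF g, of 1 e] g by (simp add: add.commute)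
  then show ?case using step1 by (simp add: magnus_letter_mult letter_act_binomial_series)
next
  case (step2 e)
  interpret group "free_group S" by (rule group_free_group)
  have g: "[(s, True)] \<in> carrier (free_group S)" using s by (rule generator_in_free_group)
  have "[(s, True)] [^]\<^bsub>free_group S\<^esub> (e - 1)
      = [(s, False)] \<otimes>\<^bsub>free_group S\<^esub> [(s, True)] [^]\<^bsub>free_group S\<^esub> e"
    using int_pow_mult[OF g, of "-1" e] g s by (simp add: int_pow_neg inverse_generator)
  moreover have "letter_act (s, False) (binomial_series s e) = binomial_series s (e - 1)"
    using letter_act_inverse[of "(s, False)" "binomial_series s (e - 1)"]
    by (simp add: letter_inv_def letter_act_binomial_series)
  ultimately show ?case using step2 by (simp add: magnus_letter_mult)
qed

text \<open>A pair \<open>(t, m)\<close> with \<open>m > 0\<close> stands for the syllable \<open>t\<^sup>m\<close> of a word in the variables, as opposed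
to the pairs \<open>(s, e)\<close> with an arbitrary integer \<open>e\<close> in products of powers.\<close>

definition syllable_word :: "('s \<times> nat) list \<Rightarrow> 's list" where
  "syllable_word ws = concat (map (\<lambda>(t, m). replicate m t) ws)"

definition syllable_coeff :: "('s \<times> int) list \<Rightarrow> ('s \<times> nat) list \<Rightarrow> int" where
  "syllable_coeff cs ws =
    prod_list (map (\<lambda>((s, e), (t, m)). if s = t then int_choose e m else 0) (zip cs ws))"

lemma syllable_word_simps [simp]:
  "syllable_word [] = []"
  "syllable_word ((t, m) # ws) = replicate m t @ syllable_word ws"
  "syllable_word (ws @ vs) = syllable_word ws @ syllable_word vs"
  by (simp_all add: syllable_word_def)

text \<open>Each factor \<open>(1 + X\<^sub>s)\<^sup>e\<close> only contributes powers of one variable, that is, at most one syllable.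
A word with as many syllables as there are factors can therefore only arise if every factor
contributes a complete syllable, and a word with more syllables cannot arise at all.\<close>

lemma magnus_syllable_product:
  assumes "fst ` set cs \<subseteq> S" "distinct_adj (map fst ws)" "0 \<notin> snd ` set ws"
    and "length cs \<le> length ws"
  shows "magnus (syllable_product S cs) (syllable_word ws)
    = (if length cs = length ws then syllable_coeff cs ws else 0)"
  using assms
proof (induction cs arbitrary: ws)
  case Nil
  then show ?case
    by (cases ws) (auto simp: magnus_one series_one_def syllable_coeff_def)
next
  case (Cons c cs)
  obtain s e where c: "c = (s, e)" by (cases c)
  obtain t m ws' where ws: "ws = (t, m) # ws'" using Cons.prems(4) by (cases ws) auto
  let ?w' = "syllable_word ws'" and ?y = "magnus (syllable_product S cs)"
  let ?w = "replicate m t @ ?w'"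
  have S: "s \<in> S" "fst ` set cs \<subseteq> S" using Cons.prems(1) by (auto simp: c)
  have m: "m > 0" "0 \<notin> snd ` set ws'" using Cons.prems(3) by (auto simp: ws)
  have adj: "distinct_adj (map fst ws')" using Cons.prems(2) by (cases ws') (auto simp: ws)
  have summand: "binomial_series s e (take k ?w) * ?y (drop k ?w)
      = (if k = m then (if s = t then int_choose e m else 0) * ?y ?w' else 0)"
    if k: "k \<le> length ?w" for k
  proof -
    consider "k < m" | "k = m" | "k > m" by linarith
    then show ?thesis
    proof cases
      case 1
      then have "drop k ?w = syllable_word ((t, m - k) # ws')" by simp
      moreover have "?y (syllable_word ((t, m - k) # ws')) = 0"
        using Cons.prems S m 1 by (subst Cons.IH) (auto simp: ws)
      ultimately show ?thesis using 1 by simp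
    next
      case 2
      then show ?thesis using m by (auto simp: binomial_series_def)
    next
      case 3
      then obtain t' m' vs where ws': "ws' = (t', m') # vs" using k by (cases ws') auto
      have "t \<noteq> t'" "m' > 0" using Cons.prems m by (auto simp: ws ws')
      moreover have "t \<in> set (take k ?w)" using 3 m(1) by auto
      moreover have "t' \<in> set (take k ?w)"
        using 3 \<open>m' > 0\<close> by (simp add: ws' set_replicate_conv_if min_def)
      ultimately have "\<not> set (take k ?w) \<subseteq> {s}" by blast
      then have "binomial_series s e (take k ?w) = 0"
        unfolding binomial_series_def by (rule if_not_P)
      then show ?thesis using 3 by (simp only: mult_zero_left if_not_P)
    qed
  qed
  have "magnus (syllable_product S (c # cs)) (syllable_word ws)
      = (\<Sum>k\<le>length ?w. binomial_series s e (take k ?w) * ?y (drop k ?w))"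
    using S by (simp add: c ws magnus_mult magnus_generator_power series_mult_eq_sum)
  also have "\<dots> = (\<Sum>k\<le>length ?w. if k = m then (if s = t then int_choose e m else 0) * ?y ?w' else 0)"
    by (intro sum.cong refl summand) simp
  also have "\<dots> = (if s = t then int_choose e m else 0) * ?y ?w'" by simp
  also have "?y ?w' = (if length cs = length ws' then syllable_coeff cs ws' else 0)"
    using Cons.prems S m adj by (intro Cons.IH) (auto simp: ws)
  finally show ?case by (simp add: c ws syllable_coeff_def)
qed

section \<open>Cyclic traces of products of powers\<close>

text \<open>The rotations of a concatenation are sorted by the block in which the rotated word starts and by
the position inside this block. The list \<open>z\<close> collects the blocks already passed in the
induction.\<close>

lemma sum_rotations_concat:
  "(\<Sum>k<length (concat xs). F (rotate k (concat xs @ z)))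
    = (\<Sum>i<length xs. \<Sum>j<length (xs ! i). F (rotate j (concat (drop i xs) @ z @ concat (take i xs))))"
  for F :: "'a list \<Rightarrow> int"
proof (induction xs arbitrary: z)
  case (Cons x xs)
  let ?c = "concat xs"
  have split: "(\<Sum>k<a + b. f k) = (\<Sum>k<a. f k) + (\<Sum>k<b. f (k + a))" for a b and f :: "nat \<Rightarrow> int"
    by (induction b) (simp_all add: add.commute add.assoc)
  have shift: "rotate (k + length x) (x @ ?c @ z) = rotate k (?c @ z @ x)" for k
    using rotate_rotate[of k "length x" "x @ ?c @ z"] rotate_append[of x "?c @ z"] by simp
  have "(\<Sum>k<length x + length ?c. F (rotate k (x @ ?c @ z)))
      = (\<Sum>k<length x. F (rotate k (x @ ?c @ z)))
        + (\<Sum>k<length ?c. F (rotate k (?c @ z @ x)))"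
    unfolding split shift ..
  also have "(\<Sum>k<length ?c. F (rotate k (?c @ z @ x)))
      = (\<Sum>i<length xs. \<Sum>j<length (xs ! i).
          F (rotate j (concat (drop i xs) @ (z @ x) @ concat (take i xs))))"
    by (rule Cons.IH)
  finally show ?case by (simp add: sum.lessThan_Suc_shift del: sum.lessThan_Suc)
qed simp

lemma distinct_adj_rotate:
  assumes "distinct_adj (xs @ [hd xs])"
  shows "distinct_adj (rotate i xs @ [hd (rotate i xs)])"
proof (induction i)
  case (Suc i)
  show ?case
  proof (cases "rotate i xs")
    case (Cons y ys)
    have "distinct_adj ((ys @ [y]) @ [hd (ys @ [y])])"
      using Suc unfolding Cons distinct_adj_append_iff[of "ys @ [y]"] by (cases ys) auto
    then show ?thesis by (simp add: Cons)
  qed simp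
qed (use assms in simp)

text \<open>A rotation that starts in the interior of a syllable cuts it into two, and thus has one syllable
more than \<open>ws\<close>; by \<open>magnus_syllable_product\<close> its coefficient vanishes. What remains are the
rotations of \<open>ws\<close> as a list of syllables.\<close>

lemma cyclic_trace_syllable_product:
  assumes cs: "fst ` set cs \<subseteq> S" and adj: "distinct_adj (map fst ws @ [hd (map fst ws)])"
    and pos: "0 \<notin> snd ` set ws" and len: "length cs \<le> length ws"
  shows "cyclic_trace (magnus (syllable_product S cs)) (syllable_word ws)
    = (if length cs = length ws then \<Sum>i<length ws. syllable_coeff cs (rotate i ws) else 0)"
proof -
  let ?F = "magnus (syllable_product S cs)"
  let ?xs = "map (\<lambda>(t, m). replicate m t) ws"
  let ?f = "\<lambda>i. if length cs = length ws then syllable_coeff cs (rotate i ws) else 0"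
  have inner: "(\<Sum>j<length (?xs ! i). ?F (rotate j (concat (drop i ?xs) @ [] @ concat (take i ?xs))))
      = ?f i" if i: "i < length ws" for i
  proof -
    obtain t m where tm: "ws ! i = (t, m)" by fastforce
    define vs where "vs = drop (Suc i) ws @ take i ws"
    have rot: "rotate i ws = (t, m) # vs"
      using i Cons_nth_drop_Suc[OF i] by (simp add: vs_def rotate_drop_take tm flip: append_Cons)
    have "concat (drop i ?xs) @ [] @ concat (take i ?xs) = syllable_word (rotate i ws)"
      using i by (simp add: syllable_word_def rotate_drop_take drop_map take_map)
    then have w: "concat (drop i ?xs) @ [] @ concat (take i ?xs) = replicate m t @ syllable_word vs"
      by (simp add: rot)
    have "distinct_adj (map fst (rotate i ws) @ [hd (map fst (rotate i ws))])"
      using distinct_adj_rotate[OF adj, of i] by (simp add: rotate_map)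
    then have adj': "distinct_adj (t # map fst vs @ [t])" by (simp add: rot)
    then have vs: "vs \<noteq> []" by auto
    have pos': "m > 0" "0 \<notin> snd ` set vs" using pos arg_cong[OF rot, of set] by auto
    have len': "length ws = Suc (length vs)" using arg_cong[OF rot, of length] by simp
    have "?F (rotate j (replicate m t @ syllable_word vs)) = (if j = 0 then ?f i else 0)"
      if "j < m" for j
    proof (cases "j = 0")
      case True
      have "distinct_adj (map fst ((t, m) # vs))"
        using adj' distinct_adj_append_iff[of "t # map fst vs" "[t]"] by simp
      then have "?F (syllable_word ((t, m) # vs)) = ?f i"
        using magnus_syllable_product[OF cs, of "(t, m) # vs"] pos' len len' by (auto simp: rot)
      then show ?thesis using True by simp
    next
      case False
      have "replicate m t = replicate j t @ replicate (m - j) t"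
        using that by (simp flip: replicate_add)
      then have "rotate j (replicate m t @ syllable_word vs)
          = syllable_word ((t, m - j) # vs @ [(t, j)])"
        using rotate_append[of "replicate j t" "replicate (m - j) t @ syllable_word vs"] by simp
      moreover have "?F (syllable_word ((t, m - j) # vs @ [(t, j)])) = 0"
        using adj' pos' False that len len'
        by (subst magnus_syllable_product[OF cs]) auto
      ultimately show ?thesis using False by simp
    qed
    then have "(\<Sum>j<m. ?F (rotate j (replicate m t @ syllable_word vs))) = (\<Sum>j<m. if j = 0 then ?f i else 0)"
      by (intro sum.cong) auto
    then show ?thesis using i pos'(1) unfolding w by (simp add: tm)
  qed
  have "cyclic_trace ?F (syllable_word ws) = (\<Sum>i<length ws. ?f i)"
    using sum_rotations_concat[of ?F ?xs "[]"] inner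
    by (simp add: cyclic_trace_def syllable_word_def)
  then show ?thesis by (simp cong: if_cong)
qed

lemma syllable_coeff_rotate:
  fixes cs :: "('a \<times> int) list"
  assumes "length cs = length ws"
  shows "syllable_coeff (rotate i cs) (rotate i ws) = syllable_coeff cs ws"
proof -
  have "zip (rotate i cs) (rotate i ws) = rotate i (zip cs ws)"
    using assms by (simp add: rotate_drop_take drop_zip take_zip zip_append)
  moreover have "mset (rotate1 xs) = mset xs" for xs :: "(('a \<times> int) \<times> 'a \<times> nat) list"
    by (cases xs) auto
  then have "mset (rotate i xs) = mset xs" for xs :: "(('a \<times> int) \<times> 'a \<times> nat) list"
    by (induction i) auto
  ultimately show ?thesis
    by (simp add: syllable_coeff_def flip: prod_mset_prod_list)
qed

text \<open>Rotating the word one way is the same as rotating the product of powers the other way.\<close>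

lemma sum_syllable_coeff_rotate:
  assumes "length cs = length ws"
  shows "(\<Sum>i<length ws. syllable_coeff cs (rotate i ws))
    = (\<Sum>i<length cs. syllable_coeff (rotate i cs) ws)"
proof -
  let ?r = "length ws"
  have full: "rotate (?r - i) (rotate i ws) = ws" if "i < ?r" for i
    using that by (simp add: rotate_rotate)
  have "(\<Sum>i<?r. syllable_coeff cs (rotate i ws)) = (\<Sum>i<?r. syllable_coeff (rotate (?r - i) cs) ws)"
  proof (rule sum.cong)
    fix i assume "i \<in> {..<?r}"
    then show "syllable_coeff cs (rotate i ws) = syllable_coeff (rotate (?r - i) cs) ws"
      using full[of i] assms syllable_coeff_rotate[of cs "rotate i ws" "?r - i"] by simp
  qed simp
  also have "\<dots> = (\<Sum>i<?r. syllable_coeff (rotate (Suc i) cs) ws)"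
    using sum.nat_diff_reindex[of "\<lambda>i. syllable_coeff (rotate (Suc i) cs) ws" ?r]
    by (simp add: Suc_diff_Suc)
  also have "\<dots> = (\<Sum>i<?r. syllable_coeff (rotate i cs) ws)"
    using sum.lessThan_Suc_shift[of "\<lambda>i. syllable_coeff (rotate i cs) ws" ?r]
      sum.lessThan_Suc[of "\<lambda>i. syllable_coeff (rotate i cs) ws" ?r] assms
    by simp
  finally show ?thesis using assms by simp
qed

section \<open>Separating integer vectors by binomial coefficients\<close>

text \<open>Integral combinations of the functions \<open>e choose m\<close> with \<open>m > 0\<close>. By \<open>int_choose_absorb\<close> they are
stable under multiplication by linear polynomials \<open>e - c\<close>, so they contain every
product of \<open>e\<close> with such linear polynomials.\<close>

inductive_set binomial_span :: "(int \<Rightarrow> int) set" where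
  base: "m > 0 \<Longrightarrow> (\<lambda>e. int_choose e m) \<in> binomial_span"
| add: "f \<in> binomial_span \<Longrightarrow> g \<in> binomial_span \<Longrightarrow> (\<lambda>e. f e + g e) \<in> binomial_span"
| scale: "f \<in> binomial_span \<Longrightarrow> (\<lambda>e. c * f e) \<in> binomial_span"

lemma binomial_span_mult_root:
  assumes "f \<in> binomial_span"
  shows "(\<lambda>e. (e - c) * f e) \<in> binomial_span"
  using assms
proof induction
  case (base m)
  have "(e - c) * int_choose e m = (int m - c) * int_choose e m + int (Suc m) * int_choose e (Suc m)" for e
    using int_choose_absorb[of e m] by (simp add: algebra_simps)
  then show ?case using base by (simp only:) (intro binomial_span.intros, simp_all)
next
  case (add f g)
  show ?case using binomial_span.add[OF add.IH] by (simp add: distrib_left)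
next
  case (scale f a)
  show ?case using binomial_span.scale[OF scale.IH, of a] by (simp add: mult.left_commute)
qed

lemma binomial_span_root_product:
  "finite T \<Longrightarrow> (\<lambda>e. e * (\<Prod>t\<in>T. e - t)) \<in> binomial_span"
proof (induction T rule: finite_induct)
  case empty
  show ?case using binomial_span.base[of "Suc 0"] by simp
next
  case (insert t T)
  show ?case using binomial_span_mult_root[OF insert.IH, of t] insert.hyps
    by (simp add: mult.left_commute)
qed

definition eval_product :: "(int \<Rightarrow> int) list \<Rightarrow> int list \<Rightarrow> int" where
  "eval_product fs z = prod_list (map2 (\<lambda>f e. f e) fs z)"

lemma eval_product_middle:
  assumes "length z = length gs + Suc (length hs)"
  shows "eval_product (gs @ f # hs) z =
    eval_product gs (take (length gs) z) * f (z ! length gs) * eval_product hs (drop (Suc (length gs)) z)"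
proof -
  have "length gs < length z" using assms by simp
  from id_take_nth_drop[OF this] have
    "eval_product (gs @ f # hs) z = eval_product (gs @ f # hs)
      (take (length gs) z @ z ! length gs # drop (Suc (length gs)) z)" by simp
  then show ?thesis using assms by (simp add: eval_product_def)
qed

text \<open>Both sides are linear in each of the functions, so the equality extends from binomial
coefficients to their span, one coordinate after the other: \<open>gs\<close> are the coordinates already
treated.\<close>

lemma eval_product_sums_extend:
  fixes x y :: "'i \<Rightarrow> int list"
  assumes len: "\<And>i. i \<in> I \<Longrightarrow> length (x i) = r" "\<And>j. j \<in> J \<Longrightarrow> length (y j) = r"
    and eq: "\<And>ms. length ms = r \<Longrightarrow> 0 \<notin> set ms \<Longrightarrow>
      (\<Sum>i\<in>I. eval_product (map (\<lambda>m e. int_choose e m) ms) (x i))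
        = (\<Sum>j\<in>J. eval_product (map (\<lambda>m e. int_choose e m) ms) (y j))"
    and "length gs + length ms = r" "set gs \<subseteq> binomial_span" "0 \<notin> set ms"
  shows "(\<Sum>i\<in>I. eval_product (gs @ map (\<lambda>m e. int_choose e m) ms) (x i))
    = (\<Sum>j\<in>J. eval_product (gs @ map (\<lambda>m e. int_choose e m) ms) (y j))"
  using assms(4-)
proof (induction gs arbitrary: ms rule: rev_induct)
  case Nil
  then show ?case using eq by simp
next
  case (snoc g gs)
  let ?hs = "map (\<lambda>m e. int_choose e m) ms"
  have gs: "set gs \<subseteq> binomial_span" and r: "r = length gs + Suc (length ms)"
    using snoc.prems by auto
  have "g \<in> binomial_span" using snoc.prems by simp
  then have "(\<Sum>i\<in>I. eval_product (gs @ g # ?hs) (x i)) = (\<Sum>j\<in>J. eval_product (gs @ g # ?hs) (y j))"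
  proof induction
    case (base m)
    then show ?case using snoc.IH[of "m # ms"] snoc.prems r gs by simp
  next
    case (add f h)
    have "eval_product (gs @ (\<lambda>e. f e + h e) # ?hs) z
        = eval_product (gs @ f # ?hs) z + eval_product (gs @ h # ?hs) z" if "length z = r" for z
      using that by (simp add: r eval_product_middle algebra_simps)
    then show ?case using add.IH len by (simp add: sum.distrib)
  next
    case (scale f c)
    have "eval_product (gs @ (\<lambda>e. c * f e) # ?hs) z = c * eval_product (gs @ f # ?hs) z"
      if "length z = r" for z
      using that by (simp add: r eval_product_middle)
    then show ?case using scale.IH len by (simp flip: sum_distrib_left)
  qed
  then show ?case by simp
qed

lemma eval_product_eq_0_iff:
  "length fs = length z \<Longrightarrow> eval_product fs z = 0 \<longleftrightarrow> (\<exists>k<length z. (fs ! k) (z ! k) = 0)"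
  by (force simp: eval_product_def prod_list_zero_iff set_zip image_iff)

text \<open>Interpolation: a product of one-variable polynomials, each a multiple of its variable, is nonzero
at \<open>x a\<close> and vanishes at all other vectors that occur. The sum over \<open>I\<close> is a positive multiple of its
value at \<open>x a\<close>, so \<open>x a\<close> has to occur also on the other side.\<close>

lemma binomial_sums_separate:
  fixes x y :: "'i \<Rightarrow> int list"
  assumes fin: "finite I" "finite J"
    and len: "\<And>i. i \<in> I \<Longrightarrow> length (x i) = r" "\<And>j. j \<in> J \<Longrightarrow> length (y j) = r"
    and eq: "\<And>ms. length ms = r \<Longrightarrow> 0 \<notin> set ms \<Longrightarrow>
      (\<Sum>i\<in>I. eval_product (map (\<lambda>m e. int_choose e m) ms) (x i))
        = (\<Sum>j\<in>J. eval_product (map (\<lambda>m e. int_choose e m) ms) (y j))"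
    and a: "a \<in> I" "0 \<notin> set (x a)"
  shows "\<exists>j\<in>J. y j = x a"
proof (rule ccontr)
  assume none: "\<not> (\<exists>j\<in>J. y j = x a)"
  define T where "T = (\<Union>i\<in>I. set (x i)) \<union> (\<Union>j\<in>J. set (y j))"
  \<comment> \<open>The interpolating polynomials, with one factor \<open>e\<close> to stay in the span.\<close>
  define fs where "fs = map (\<lambda>e0 e. e * (\<Prod>t\<in>T - {e0}. e - t)) (x a)"
  have finT: "finite T" using fin by (simp add: T_def)
  have lenfs: "length fs = r" using len a by (simp add: fs_def)
  have "set fs \<subseteq> binomial_span"
    using finT by (auto simp: fs_def intro!: binomial_span_root_product)
  then have sums: "(\<Sum>i\<in>I. eval_product fs (x i)) = (\<Sum>j\<in>J. eval_product fs (y j))"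
    using eval_product_sums_extend[OF len eq, of fs "[]"] lenfs by simp
  have other: "eval_product fs z = 0" if z: "length z = r" "set z \<subseteq> T" "z \<noteq> x a" for z
  proof -
    obtain k where k: "k < r" "z ! k \<noteq> x a ! k"
      using z len a by (metis nth_equalityI)
    have "z ! k \<in> T - {x a ! k}" using k z by auto
    then have "(\<Prod>t\<in>T - {x a ! k}. z ! k - t) = 0" using finT by (intro prod_zero) auto
    then have "(fs ! k) (z ! k) = 0" using k len a by (simp add: fs_def)
    then show ?thesis using k z lenfs eval_product_eq_0_iff[of fs z] by auto
  qed
  have self: "eval_product fs (x a) \<noteq> 0"
  proof -
    have "(fs ! k) (x a ! k) \<noteq> 0" if "k < r" for k
    proof -
      have "x a ! k \<noteq> 0" using that a len nth_mem[of k "x a"] by metis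
      then show ?thesis using that a len finT by (simp add: fs_def)
    qed
    then show ?thesis using eval_product_eq_0_iff[of fs "x a"] len a lenfs by simp
  qed
  have "(\<Sum>j\<in>J. eval_product fs (y j)) = 0"
    using none len by (intro sum.neutral) (auto intro!: other simp: T_def)
  moreover have "(\<Sum>i\<in>I. eval_product fs (x i)) = (\<Sum>i\<in>I. if x i = x a then eval_product fs (x a) else 0)"
    using len by (intro sum.cong) (auto intro!: other simp: T_def)
  moreover have "\<dots> = int (card {i \<in> I. x i = x a}) * eval_product fs (x a)"
    using fin by (simp add: sum.inter_filter[symmetric])
  moreover have "card {i \<in> I. x i = x a} \<noteq> 0" using fin a by auto
  ultimately show False using self sums by simp
qed


section \<open>Cyclic traces separate conjugacy classes\<close>

lemma syllable_coeff_zip: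
  assumes "length ds = length gs" "length gs = length ms"
  shows "syllable_coeff ds (zip gs ms)
    = (if map fst ds = gs then eval_product (map (\<lambda>m e. int_choose e m) ms) (map snd ds) else 0)"
  using assms
  by (induction ds gs ms rule: list_induct3) (auto simp: syllable_coeff_def eval_product_def)

lemma set_syllable_word: "set (syllable_word ws) \<subseteq> fst ` set ws"
  by (force simp: syllable_word_def)

text \<open>For two or more powers, words are chosen whose syllables use the generators of \<open>cs\<close> in the same
order. Only rotations of \<open>cs\<close> and \<open>ds\<close> with this sequence of generators contribute, and the
resulting sums over exponent vectors are compared by \<open>binomial_sums_separate\<close>. A single power
cannot be treated in this way, since all rotations of \<open>t\<^sup>m\<close> are the same word; here the
exponent is read off from the word \<open>[s]\<close>.\<close>

lemma cyclic_traces_determine_rotation: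
  assumes cs: "fst ` set cs \<subseteq> S" "cyclically_reduced cs"
    and ds: "fst ` set ds \<subseteq> S" "length ds \<le> length cs"
    and eq: "\<And>w. set w \<subseteq> S \<Longrightarrow>
      cyclic_trace (magnus (syllable_product S cs)) w = cyclic_trace (magnus (syllable_product S ds)) w"
  shows "\<exists>i. rotate i ds = cs"
proof -
  consider "cs = []" | s e where "cs = [(s, e)]" | "length cs > 1"
    by (cases cs rule: remdups_adj.cases) auto
  then show ?thesis
  proof cases
    case 1
    then show ?thesis using ds by simp
  next
    case 2
    have "magnus (syllable_product S xs) [s] = (if length xs = 1 then syllable_coeff xs [(s, 1)] else 0)"
      if "fst ` set xs \<subseteq> S" "length xs \<le> 1" for xs
      using magnus_syllable_product[OF that(1), of "[(s, 1)]"] that(2) by simp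
    from this[of cs] this[of ds]
    have "(if length ds = 1 then syllable_coeff ds [(s, 1)] else 0) = e"
      using eq[of "[s]"] cs ds unfolding 2 by (simp add: cyclic_trace_def syllable_coeff_def)
    moreover have "e \<noteq> 0" using cs(2) 2 by (simp add: cyclically_reduced_def)
    ultimately have "ds = cs"
      using 2 by (cases ds) (auto simp: syllable_coeff_def split: if_splits)
    then show ?thesis by (intro exI[of _ 0]) simp
  next
    case 3
    let ?r = "length cs" and ?gs = "map fst cs"
    let ?ev = "\<lambda>ms xs. eval_product (map (\<lambda>m e. int_choose e m) ms) (map snd xs)"
    define I where "I = {i \<in> {..<?r}. map fst (rotate i cs) = ?gs}"
    define J where "J = {j \<in> {..<?r}. length ds = ?r \<and> map fst (rotate j ds) = ?gs}"
    have "(\<Sum>i\<in>I. ?ev ms (rotate i cs)) = (\<Sum>j\<in>J. ?ev ms (rotate j ds))"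
      if ms: "length ms = ?r" "0 \<notin> set ms" for ms
    proof -
      let ?ws = "zip ?gs ms"
      have fst_ws: "map fst ?ws = ?gs" using ms by simp
      have "0 \<notin> snd ` set ?ws" using ms(2) by (auto dest: set_zip_rightD)
      moreover have "distinct_adj (map fst ?ws @ [hd (map fst ?ws)])"
        using cs(2) 3 unfolding fst_ws by (simp add: cyclically_reduced_def)
      moreover have w: "set (syllable_word ?ws) \<subseteq> S"
        using set_syllable_word[of ?ws] arg_cong[OF fst_ws, of set] cs(1) by simp
      ultimately have "cyclic_trace (magnus (syllable_product S xs)) (syllable_word ?ws)
          = (if length xs = ?r then \<Sum>i<?r. syllable_coeff (rotate i xs) ?ws else 0)"
        if "fst ` set xs \<subseteq> S" "length xs \<le> ?r" for xs
        using cyclic_trace_syllable_product[OF that(1), of ?ws] sum_syllable_coeff_rotate[of xs ?ws]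
          that ms(1) by simp
      then have "(\<Sum>i<?r. syllable_coeff (rotate i cs) ?ws)
          = (if length ds = ?r then \<Sum>i<?r. syllable_coeff (rotate i ds) ?ws else 0)"
        using eq[OF w] cs ds by simp
      also have "\<dots> = (\<Sum>j\<in>J. ?ev ms (rotate j ds))"
        using ms(1) by (auto simp: J_def syllable_coeff_zip simp flip: sum.inter_filter)
      also have "(\<Sum>i<?r. syllable_coeff (rotate i cs) ?ws) = (\<Sum>i\<in>I. ?ev ms (rotate i cs))"
        using ms(1) by (simp add: I_def syllable_coeff_zip flip: sum.inter_filter)
      finally show ?thesis .
    qed
    then have "\<exists>j\<in>J. map snd (rotate j ds) = map snd (rotate 0 cs)"
      using 3 cs(2)
      by (intro binomial_sums_separate[where I = I and r = ?r])
        (auto simp: I_def J_def cyclically_reduced_def)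
    then obtain j where "map snd (rotate j ds) = map snd cs" "map fst (rotate j ds) = map fst cs"
      by (auto simp: J_def)
    then have "rotate j ds = cs" by (metis zip_map_fst_snd)
    then show ?thesis ..
  qed
qed

theorem cyclic_traces_separate_conjugacy_classes:
  assumes "u \<in> carrier (free_group S)" "v \<in> carrier (free_group S)"
    and eq: "\<And>w. set w \<subseteq> S \<Longrightarrow> cyclic_trace (magnus u) w = cyclic_trace (magnus v) w"
  shows "conjugate_in (free_group S) u v"
proof -
  let ?F = "free_group S"
  interpret group ?F by (rule group_free_group)
  have normal_form: "\<exists>cs. fst ` set cs \<subseteq> S \<and> cyclically_reduced cs
      \<and> conjugate_in ?F x (syllable_product S cs)" if "x \<in> carrier ?F" for x
    using carrier_is_syllable_product[OF that] conjugate_to_cyclically_reduced by metis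
  have trace: "cyclic_trace (magnus y) = cyclic_trace (magnus x)"
    if "x \<in> carrier ?F" "conjugate_in ?F x y" for x y
    using that cyclic_trace_conjugation unfolding conjugate_in_def by blast
  obtain cs where cs: "fst ` set cs \<subseteq> S" "cyclically_reduced cs"
    "conjugate_in ?F u (syllable_product S cs)" using normal_form assms(1) by blast
  obtain ds where ds: "fst ` set ds \<subseteq> S" "cyclically_reduced ds"
    "conjugate_in ?F v (syllable_product S ds)" using normal_form assms(2) by blast
  have eq': "cyclic_trace (magnus (syllable_product S cs)) w
      = cyclic_trace (magnus (syllable_product S ds)) w" if "set w \<subseteq> S" for w
    using eq[OF that] trace[OF assms(1) cs(3)] trace[OF assms(2) ds(3)] by simp
  note closed = syllable_product_closed[OF cs(1)] syllable_product_closed[OF ds(1)]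
  have "conjugate_in ?F (syllable_product S cs) (syllable_product S ds)"
  proof (cases "length ds \<le> length cs")
    case True
    then obtain i where "rotate i ds = cs"
      using cyclic_traces_determine_rotation[OF cs(1,2) ds(1)] eq' by blast
    then show ?thesis
      using conjugate_syllable_product_rotate[OF ds(1), of i] conjugate_in_sym closed by metis
  next
    case False
    then obtain i where "rotate i cs = ds"
      using cyclic_traces_determine_rotation[OF ds(1,2) cs(1)] eq' by (metis nat_le_linear)
    then show ?thesis using conjugate_syllable_product_rotate[OF cs(1), of i] by metis
  qed
  then show ?thesis
    using assms(1,2) cs(3) ds(3) conjugate_in_trans conjugate_in_sym by metis
qed

section \<open>The linear part of the Magnus expansion and homology\<close>

text \<open>The coefficient of \<open>[t]\<close>, the exponent sum of \<open>t\<close>, is a homomorphism to the integers. So it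
vanishes on commutators, and modulo \<open>m\<close> it factors through the first homology modulo \<open>m\<close>.\<close>

lemma magnus_linear_mult:
  "magnus (x \<otimes>\<^bsub>free_group S\<^esub> y) [t] = magnus x [t] + magnus y [t]"
  by (simp add: magnus_mult magnus_at_Nil)

lemma magnus_linear_inverse:
  assumes "x \<in> carrier (free_group S)"
  shows "magnus (inv\<^bsub>free_group S\<^esub> x) [t] = - magnus x [t]"
proof -
  interpret group "free_group S" by (rule group_free_group)
  show ?thesis
    using magnus_linear_mult[of S x "inv\<^bsub>free_group S\<^esub> x" t] magnus_one[of S] assms
    by (simp add: series_one_def)
qed

lemma magnus_linear_pow:
  assumes "x \<in> carrier (free_group S)"
  shows "magnus (x [^]\<^bsub>free_group S\<^esub> (m::nat)) [t] = int m * magnus x [t]"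
proof -
  interpret group "free_group S" by (rule group_free_group)
  show ?thesis
    by (induction m) (use magnus_one[of S] in
        \<open>simp_all add: magnus_linear_mult series_one_def distrib_right\<close>)
qed

lemma magnus_linear_derived:
  assumes "x \<in> derived (free_group S) (carrier (free_group S))"
  shows "magnus x [t] = 0"
proof -
  interpret group "free_group S" by (rule group_free_group)
  have com: "magnus c [t] = 0" "c \<in> carrier (free_group S)"
    if "c \<in> derived_set (free_group S) (carrier (free_group S))" for c
    using that by (auto simp: magnus_linear_mult magnus_linear_inverse)
  show ?thesis
    using assms unfolding derived_def
  proof induction
    case one
    show ?case using magnus_one[of S] by (simp add: series_one_def)
  next
    case (incl h)
    then show ?case by (rule com)
  next
    case (inv h)
    then show ?case by (simp only: magnus_linear_inverse[OF com(2)] com(1) minus_zero)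
  next
    case (eng h1 h2)
    then show ?case by (simp only: magnus_linear_mult add_0)
  qed
qed

text \<open>If \<open>\<phi>\<close> fixes the class of \<open>x\<close> in the homology modulo \<open>m\<close>, then \<open>\<phi> x\<close> is the product of an element
of the derived subgroup, an \<open>m\<close>-th power and \<open>x\<close>.\<close>

lemma IA_representative:
  assumes "\<theta> \<in> IA m (free_group S)"
  obtains \<phi> where "\<phi> \<in> auto (free_group S)"
    "\<theta> = inner_auto (free_group S) #>\<^bsub>AutoGroup (free_group S)\<^esub> \<phi>"
    "\<And>x t. x \<in> carrier (free_group S) \<Longrightarrow> [magnus (\<phi> x) [t] = magnus x [t]] (mod int m)"
proof -
  let ?F = "free_group S"
  let ?D = "derived ?F (carrier ?F)"
  let ?A = "abelianization ?F"
  let ?P = "powers m ?A"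
  interpret group ?F by (rule group_free_group)
  interpret A: comm_group ?A by (rule comm_group_abelianization)
  interpret D: normal ?D ?F by (rule derived_self_is_normal)
  interpret P: normal ?P ?A by (rule powers_abelianization_normal)
  obtain \<phi> where \<phi>: "\<phi> \<in> auto ?F" "\<theta> = inner_auto ?F #>\<^bsub>AutoGroup ?F\<^esub> \<phi>"
    using assms by (auto simp: IA_def kernel_def carrier_OutGroup)
  let ?q = "quotient_map ?F ?D \<phi>"
  have H1: "H1_map m ?F \<phi> = (\<lambda>X \<in> carrier (H1_mod m ?F). X)"
    using assms \<phi> by (simp add: IA_def kernel_def Out_H1_eq AutoGroup_simps)
  have pi: "group_hom ?F ?A (\<lambda>x. ?D #>\<^bsub>?F\<^esub> x)"
    using D.r_coset_hom_Mod A.is_group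
    by (simp add: group_hom_def group_hom_axioms_def is_group abelianization_def)
  interpret pi: group_hom ?F ?A "\<lambda>x. ?D #>\<^bsub>?F\<^esub> x" by (rule pi)
  have "[magnus (\<phi> x) [t] = magnus x [t]] (mod int m)" if x: "x \<in> carrier ?F" for x t
  proof -
    have \<phi>x: "\<phi> x \<in> carrier ?F" using \<phi>(1) x by (rule autoD)
    let ?X = "?D #>\<^bsub>?F\<^esub> x" and ?Y = "?D #>\<^bsub>?F\<^esub> \<phi> x"
    have q: "?q ?X = ?Y"
      using \<phi>(1) x by (intro D.quotient_map_coset auto_image_derived)
    have "?P #>\<^bsub>?A\<^esub> ?X \<in> carrier (H1_mod m ?F)"
      using x by (simp add: H1_mod_def carrier_FactGroup)
    then have "?P #>\<^bsub>?A\<^esub> ?X = H1_map m ?F \<phi> (?P #>\<^bsub>?A\<^esub> ?X)" by (simp add: H1)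
    also have "\<dots> = ?P #>\<^bsub>?A\<^esub> ?Y"
      unfolding H1_map_def q[symmetric] using \<phi>(1) x
      by (intro P.quotient_map_coset abelianization_map abelianization_image_powers pi.hom_closed)
    finally have "?Y \<in> ?P #>\<^bsub>?A\<^esub> ?X"
      using A.rcos_self[OF pi.hom_closed[OF \<phi>x] P.subgroup_axioms] by simp
    then obtain y where y: "y \<in> carrier ?F" "?Y = (?D #>\<^bsub>?F\<^esub> y) [^]\<^bsub>?A\<^esub> m \<otimes>\<^bsub>?A\<^esub> ?X"
      unfolding r_coset_def[of ?A] powers_def
      by (auto simp: abelianization_def carrier_FactGroup)
    then have "?Y = ?D #>\<^bsub>?F\<^esub> (y [^]\<^bsub>?F\<^esub> m \<otimes>\<^bsub>?F\<^esub> x)"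
      using x by (simp add: pi.hom_nat_pow)
    then have "\<phi> x \<in> ?D #>\<^bsub>?F\<^esub> (y [^]\<^bsub>?F\<^esub> m \<otimes>\<^bsub>?F\<^esub> x)"
      using rcos_self[OF \<phi>x D.subgroup_axioms] by simp
    then obtain d where "d \<in> ?D" "\<phi> x = d \<otimes>\<^bsub>?F\<^esub> (y [^]\<^bsub>?F\<^esub> m \<otimes>\<^bsub>?F\<^esub> x)"
      unfolding r_coset_def by blast
    then have "magnus (\<phi> x) [t] = int m * magnus y [t] + magnus x [t]"
      using y(1) by (simp add: magnus_linear_mult magnus_linear_derived magnus_linear_pow)
    then show ?thesis by (simp add: cong_def)
  qed
  with \<phi> show thesis by (rule that)
qed


section \<open>Periodic conjugacy classes\<close>

lemma (in group) Out_conj_pow: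
  assumes "\<theta> \<in> carrier (OutGroup G)" "c \<in> conj_classes G"
  shows "Out_conj G (\<theta> [^]\<^bsub>OutGroup G\<^esub> (k::nat)) c = (Out_conj G \<theta> ^^ k) c"
proof -
  interpret act: group_action "OutGroup G" "conj_classes G" "Out_conj G"
    by (rule Out_conj_action)
  interpret O: group "OutGroup G" by (rule group_OutGroup)
  show ?thesis using assms(2)
  proof (induction k arbitrary: c)
    case 0
    have "Out_conj G \<one>\<^bsub>OutGroup G\<^esub> c = (\<lambda>d \<in> conj_classes G. d) c"
      by (simp only: act.id_eq_one)
    then show ?case using 0 by simp
  next
    case (Suc k)
    have "Out_conj G \<theta> c \<in> conj_classes G" using act.element_image[OF assms(1) Suc.prems] by blast
    then show ?case
      using Suc act.composition_rule[OF Suc.prems O.nat_pow_closed[OF assms(1)] assms(1)]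
      by (simp add: funpow_swap1)
  qed
qed

theorem theorem4p1:
  fixes n :: nat
  assumes "\<theta> \<in> IA 3 (free_group {..<n})"
    and "c \<in> conj_classes (free_group {..<n})"
    and "periodic_class (free_group {..<n}) \<theta> c"
  shows "Out_conj (free_group {..<n}) \<theta> c = c"
proof -
  let ?F = "free_group {..<n}"
  interpret group ?F by (rule group_free_group)
  obtain \<phi> where \<phi>: "\<phi> \<in> auto ?F" "\<theta> = inner_auto ?F #>\<^bsub>AutoGroup ?F\<^esub> \<phi>"
    and lin: "\<And>x t. x \<in> carrier ?F \<Longrightarrow> [magnus (\<phi> x) [t] = magnus x [t]] (mod int 3)"
    by (rule IA_representative[OF assms(1)]) blast
  interpret homology_trivial_endomorphism "{..<n}" \<phi>
  proof
    show "\<phi> \<in> hom ?F ?F" using \<phi>(1) by (rule autoD)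
    fix s t assume "s \<in> {..<n}"
    from lin[OF generator_in_free_group[OF this], of True t]
    show "[magnus (\<phi> [(s, True)]) [t] = (if s = t then 1 else 0)] (mod 3)"
      by (simp add: magnus_Cons magnus_Nil series_one_def eq_commute split: if_splits)
  qed simp
  obtain u where u: "u \<in> carrier ?F" "c = orbit ?F (conjugation ?F) u"
    using assms(2) by (auto simp: conj_classes_eq)
  have image: "Out_conj ?F \<theta> (orbit ?F (conjugation ?F) v) = orbit ?F (conjugation ?F) (\<phi> v)"
    if "v \<in> carrier ?F" for v
  proof -
    have v: "orbit ?F (conjugation ?F) v \<in> conj_classes ?F" using that by (simp add: conj_classes_eq)
    show ?thesis
      unfolding \<phi>(2) Out_conj_eq[OF \<phi>(1) v] by (rule auto_image_class[OF \<phi>(1) that])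
  qed
  have iterate: "(Out_conj ?F \<theta> ^^ k) c = orbit ?F (conjugation ?F) ((\<phi> ^^ k) u)" for k
    using u by (induction k) (simp_all add: image iterate_closed)
  have "\<theta> \<in> carrier (OutGroup ?F)" using assms(1) by (simp add: IA_def kernel_def)
  then obtain k where k: "k \<ge> 1" "orbit ?F (conjugation ?F) ((\<phi> ^^ k) u) = c"
    using assms(2,3) by (auto simp: periodic_class_def Out_conj_pow iterate)
  have self: "v \<in> orbit ?F (conjugation ?F) v" if "v \<in> carrier ?F" for v
    using conjugate_in_refl[OF that] by (auto simp: conjugate_in_def orbit_conjugation)
  have "(\<phi> ^^ k) u \<in> c" using self[OF iterate_closed[OF u(1), of k]] k(2) by simp
  then obtain g where g: "g \<in> carrier ?F" "(\<phi> ^^ k) u = conjugation ?F g u"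
    by (auto simp: u(2) orbit_conjugation)
  have "conjugate_in ?F u (\<phi> u)"
    using cyclic_traces_separate_conjugacy_classes[of u "{..<n}" "\<phi> u"] u(1)
      cyclic_trace_invariant[OF u(1) _ k(1) g] by simp
  then obtain h where h: "h \<in> carrier ?F" "\<phi> u = conjugation ?F h u"
    unfolding conjugate_in_def by blast
  have "orbit ?F (conjugation ?F) (\<phi> u) = conjugation ?F h ` c"
    using auto_image_class[OF conjugation_auto[OF h(1)] u(1)] by (simp add: h(2) u(2))
  also have "\<dots> = c" by (rule conjugation_image_class[OF h(1) assms(2)])
  finally show ?thesis using image[OF u(1)] u(2) by simp
qed

end
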